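(* Let $X$ be a standard Borel space and let $G$ be a locally finite, non-smooth Borel graph on $X$. Then there exists a Borel map $x \mapsto f_x$ from $X$ to $\mathbb{N}^{\mathbb{N}}$ such that for every Borel marker sequence $\{A_n\}_{n \in \mathbb{N}}$ for $G$, there exists an $x \in X$ such that for all $n \in \mathbb{N}$, $d_G(x,A_n) < f_x(n)$.
   Context: A Borel graph on a standard Borel space $X$ is a graph with vertex set $X$ whose (symmetric) adjacency relation is a Borel subset of $X \times X$; it is locally finite if every vertex has finitely many neighbors. The connectedness relation of $G$ is the equivalence relation $E_G$ on $X$ whose classes are the connected components of $G$. $G$ is smooth if $E_G$ is smooth, i.e. there are a standard Borel space $Y$ and a Borel map $\varphi : X \to Y$ such that $x \mathrel{E_G} y \iff \varphi(x) = \varphi(y)$ for all $x,y \in X$; $G$ is non-smooth otherwise. A marker set for $G$ is a set $A \subseteq X$ that meets every connected component of $G$. A Borel marker sequence for $G$ is a sequence $\{A_n\}_{n \in \mathbb{N}}$ of Borel marker sets for $G$ (no monotonicity or disjointness is required). $d_G$ denotes the graph distance in $G$, and $d_G(x,A) = \min\{d_G(x,y) : y \in A\}$, where $y$ ranges over the points of $A$ in the connected component of $x$. $\mathbb{N}^{\mathbb{N}}$ is the Baire space of functions $\mathbb{N} \to \mathbb{N}$, where $\mathbb{N} = \{0,1,2,\ldots\}$. *)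

theory Defs
  imports "HOL-Analysis.Analysis" "HOL-Library.Extended_Nat"
begin

text \<open>
  A measure \<open>X\<close> serves only as the measurable space \<open>(space X, sets X)\<close>; its measure
  component is irrelevant.
\<close>

definition standard_borel_space :: "'a measure \<Rightarrow> bool" where
  "standard_borel_space X \<longleftrightarrow>
     (\<exists>T. completely_metrizable_space T \<and> separable_space T \<and> topspace T = space X \<and>
          sets X = sigma_sets (topspace T) {U. openin T U})"

text \<open>Graphs are simple, given by a symmetric and irreflexive adjacency relation.\<close>

definition borel_graph :: "'a measure \<Rightarrow> ('a \<times> 'a) set \<Rightarrow> bool" where
  "borel_graph X G \<longleftrightarrow> sym G \<and> irrefl G \<and> G \<in> sets (X \<Otimes>\<^sub>M X)"

definition locally_finite_graph :: "'a measure \<Rightarrow> ('a \<times> 'a) set \<Rightarrow> bool" where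
  "locally_finite_graph X G \<longleftrightarrow> (\<forall>x\<in>space X. finite (G `` {x}))"

definition connectedness_rel :: "'a measure \<Rightarrow> ('a \<times> 'a) set \<Rightarrow> ('a \<times> 'a) set" where
  "connectedness_rel X G = {(x, y). x \<in> space X \<and> y \<in> space X \<and> (x, y) \<in> G\<^sup>*}"

text \<open>
  HOL cannot quantify over the type carrying \<open>Y\<close>.  Taking it to be \<open>real\<close> loses no generality:
  a standard Borel space has at most continuum many points, so its Borel structure can be
  transported along an injection to one on a set of reals.  The structure on
  \<open>space Y\<close> need not be the one inherited from the reals.
\<close>

definition smooth_graph :: "'a measure \<Rightarrow> ('a \<times> 'a) set \<Rightarrow> bool" where
  "smooth_graph X G \<longleftrightarrow>
     (\<exists>(Y :: real measure) \<phi>. standard_borel_space Y \<and> \<phi> \<in> measurable X Y \<and>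
        (\<forall>x\<in>space X. \<forall>y\<in>space X. (x, y) \<in> connectedness_rel X G \<longleftrightarrow> \<phi> x = \<phi> y))"

definition marker_set :: "'a measure \<Rightarrow> ('a \<times> 'a) set \<Rightarrow> 'a set \<Rightarrow> bool" where
  "marker_set X G A \<longleftrightarrow>
     A \<subseteq> space X \<and> (\<forall>C \<in> space X // connectedness_rel X G. A \<inter> C \<noteq> {})"

definition borel_marker_sequence ::
  "'a measure \<Rightarrow> ('a \<times> 'a) set \<Rightarrow> (nat \<Rightarrow> 'a set) \<Rightarrow> bool" where
  "borel_marker_sequence X G A \<longleftrightarrow> (\<forall>n. A n \<in> sets X \<and> marker_set X G (A n))"

text \<open>The least length of a walk from \<open>x\<close> to \<open>y\<close>, and \<open>\<infinity>\<close> if there is none.\<close>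

definition graph_dist :: "('a \<times> 'a) set \<Rightarrow> 'a \<Rightarrow> 'a \<Rightarrow> enat" where
  "graph_dist G x y = (INF n\<in>{n. (x, y) \<in> G ^^ n}. enat n)"

text \<open>
  An infimum in \<open>enat\<close> over a nonempty set is attained, so this is a minimum whenever
  \<open>A\<close> meets the component of \<open>x\<close>, as marker sets do.
\<close>

definition graph_set_dist ::
  "'a measure \<Rightarrow> ('a \<times> 'a) set \<Rightarrow> 'a \<Rightarrow> 'a set \<Rightarrow> enat" where
  "graph_set_dist X G x A = (INF y\<in>{y\<in>A. (x, y) \<in> connectedness_rel X G}. graph_dist G x y)"

end

theory Submission
  imports Defs
begin

text \<open>The theorem combines a dichotomy in the style of Glimm and Effros with Hechler forcing, expressed
  as a Baire category argument.

  The values \<open>f a n\<close> have to exceed the distances from \<open>a\<close> to \<open>A n\<close> at one point \<open>a\<close>, which may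
  depend on the whole marker sequence.  Suppose that some points are indexed injectively by the sequences \<open>x\<close> of
  naturals, in such a way that changing finitely many values of \<open>x\<close> moves the point inside its component.
  Then \<open>f\<close> can be read off from \<open>x\<close>, and \<open>x\<close> only has to grow fast enough to dominate data
  extracted from the markers.  Consider the Hechler
  topology, in which a neighbourhood fixes a prefix and imposes a lower bound on the rest.  Borel sets have the
  Baire property in it (\<open>hechler_baire_property\<close>).  Since all points are at a finite distance from
  \<open>A n\<close>, those at some distance \<open>r n\<close> are comeager in some neighbourhood with a prefix of length \<open>m n\<close>.
  A generic \<open>x\<close> above all the bounds can be moved into the \<open>n\<close>-th neighbourhood by changing a prefix, and
  this costs a distance that \<open>x\<close> itself bounds (\<open>hechler_domination\<close>, \<open>marker_domination\<close>).

  The required index sequences come from nonsmoothness.  After a change of topology the edges of the graph are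
  covered by countably many continuous injections with open domains in a closed set of sequences
  (\<open>graph_realization\<close>).  If every point were isolated in its orbit, the basic open sets that an orbit meets
  would determine it, and the graph would be smooth (\<open>smooth_if_orbits_discrete\<close>).  So some point \<open>p\<close> is
  an accumulation point of its orbit.  Then maps along paths that start at \<open>p\<close> move ever smaller
  neighbourhoods of \<open>p\<close> to disjoint ones (\<open>splitting_scheme_exists\<close>), and composing them according to a
  binary sequence embeds the binary sequences into the space so that a finite difference of sequences
  becomes a finite distance with an explicit bound (\<open>lim_act_dist\<close>).  Sequences of naturals are coded by
  the binary sequences that describe their graphs.

  The change of topology rests on two facts.  Every Borel set is clopen in a finer Polish topology
  (\<open>borel_resolvable\<close>), and a Borel relation with finite sections is a countable union of graphs of
  Borel maps (\<open>finite_sections_uniformization\<close>).  The latter is deduced from Novikov's theorem that countably many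
  analytic sets with empty intersection can be enlarged to Borel sets with empty intersection
  (\<open>novikov_separation\<close>).\<close>

section \<open>Sequences of natural numbers\<close>

text \<open>A sequence of naturals is read as a matrix by pairing the indices; \<open>slice k w\<close> is its
  \<open>k\<close>-th row and \<open>pack\<close> rebuilds the sequence from the rows.  Pairs and countable families of
  sequences are coded in this way throughout, so that a single type serves all Polish spaces that occur.\<close>
definition slice :: "nat \<Rightarrow> (nat \<Rightarrow> nat) \<Rightarrow> nat \<Rightarrow> nat" where
  "slice k w = (\<lambda>i. w (prod_encode (k, i)))"

definition pack :: "(nat \<Rightarrow> nat \<Rightarrow> nat) \<Rightarrow> nat \<Rightarrow> nat" where
  "pack W n = (case prod_decode n of (k, i) \<Rightarrow> W k i)"

lemma slice_pack [simp]: "slice k (pack W) = W k"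
  by (simp add: slice_def pack_def)

lemma pack_slice: "pack (\<lambda>k. slice k w) = w"
  by (rule ext) (auto simp: slice_def pack_def split: prod.split dest: arg_cong[of _ _ prod_encode])

lemma pack_eqI: "(\<And>k. slice k w = W k) \<Longrightarrow> w = pack W"
  by (metis pack_slice ext)

lemma pack_0 [simp]: "pack W 0 = W 0 0"
  by (simp add: pack_def prod_decode_def prod_decode_aux.simps)

lemma continuous_coord: "continuous_on UNIV (\<lambda>w :: nat \<Rightarrow> nat. w i)"
  by (rule continuous_on_product_coordinates)

lemma continuous_on_slice [continuous_intros]:
  "continuous_on S f \<Longrightarrow> continuous_on S (\<lambda>x. slice k (f x))"
  unfolding slice_def
  by (rule continuous_on_coordinatewise_then_product)
    (rule continuous_on_product_then_coordinatewise)

text \<open>Both \<open>borel\<close> and \<open>count_space UNIV\<close> occur as the structure on \<open>nat\<close> when measurability is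
  proved automatically; the following rules mediate between them.\<close>
lemma borel_measurable_into_nat:
  fixes f :: "'b \<Rightarrow> nat"
  shows "f \<in> measurable M (count_space UNIV) \<Longrightarrow> f \<in> borel_measurable M"
  by (rule measurable_compose[of f M "count_space UNIV" "\<lambda>x. x"]) auto

lemma measurable_coord [measurable (raw)]:
  fixes f :: "'b \<Rightarrow> nat \<Rightarrow> nat"
  assumes "f \<in> borel_measurable M"
  shows "(\<lambda>x. f x i) \<in> borel_measurable M"
  using measurable_product_then_coordinatewise[OF assms] by simp

lemma measurable_coord_count [measurable (raw)]:
  fixes f :: "'b \<Rightarrow> nat \<Rightarrow> nat"
  assumes "f \<in> borel_measurable M"
  shows "(\<lambda>x. f x i) \<in> measurable M (count_space UNIV)"
  using measurable_coord[OF assms] measurable_cong_sets[OF refl sets_borel_eq_count_space] by blast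

lemma measurable_slice [measurable (raw)]:
  "f \<in> borel_measurable M \<Longrightarrow> (\<lambda>x. slice k (f x)) \<in> borel_measurable M"
  unfolding slice_def
  by (rule measurable_coordinatewise_then_product) measurable

lemma measurable_pack:
  assumes "\<And>k. (\<lambda>x. W x k) \<in> borel_measurable M"
  shows "(\<lambda>x. pack (W x)) \<in> borel_measurable M"
proof (rule measurable_coordinatewise_then_product)
  fix n
  obtain k i where "prod_decode n = (k, i)" by force
  then show "(\<lambda>x. pack (W x) n) \<in> borel_measurable M"
    using measurable_coord[OF assms, of k i] by (simp add: pack_def)
qed

lemma open_coord: "open {w :: nat \<Rightarrow> nat. w i \<in> A}"
  using open_vimage[OF open_discrete[of A] continuous_coord[of i]]
  by (simp add: vimage_def)

lemma open_coord_pred: "open {w :: nat \<Rightarrow> nat. P (w i)}"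
  using open_coord[of i "Collect P"] by simp

lemma open_coord2: "open {w :: nat \<Rightarrow> nat. Q (w i) (w j)}"
proof -
  have "{w :: nat \<Rightarrow> nat. Q (w i) (w j)} = (\<Union>k. {w. w i \<in> {k}} \<inter> {w. w j \<in> {m. Q k m}})"
    by auto
  then show ?thesis
    by (auto intro!: open_UN open_Int open_coord_pred)
qed

lemma closed_coord2: "closed {w :: nat \<Rightarrow> nat. Q (w i) (w j)}"
  unfolding closed_def using open_coord2[of "\<lambda>a b. \<not> Q a b" i j] by (simp add: Compl_eq)

lemma open_imp_cylinder:
  fixes p :: "nat \<Rightarrow> nat"
  assumes "open U" "p \<in> U"
  shows "\<exists>l. \<forall>a. (\<forall>i<l. a i = p i) \<longrightarrow> a \<in> U"
proof -
  obtain W where W: "p \<in> (\<Pi>\<^sub>E i\<in>UNIV. W i)" "finite {i. W i \<noteq> UNIV}" "(\<Pi>\<^sub>E i\<in>UNIV. W i) \<subseteq> U"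
    using product_topology_open_contains_basis[of "\<lambda>_. euclidean" UNIV U p] assms
    by (auto simp: open_fun_def)
  obtain l where l: "\<And>i. W i \<noteq> UNIV \<Longrightarrow> i < l"
    using finite_nat_bounded[OF W(2)] by blast
  have "a \<in> U" if "\<forall>i<l. a i = p i" for a
  proof -
    have "a i \<in> W i" for i
      using l[of i] that W(1) by (cases "W i = UNIV") (auto simp: PiE_def Pi_def)
    then show ?thesis using W(3) by (auto simp: PiE_def Pi_def)
  qed
  then show ?thesis by blast
qed

lemma open_cylinder: "open {a :: nat \<Rightarrow> nat. \<forall>i<l. a i = p i}"
proof -
  have "{a :: nat \<Rightarrow> nat. \<forall>i<l. a i = p i} = (\<Inter>i\<in>{..<l}. {a. a i \<in> {p i}})" by auto
  then show ?thesis by (auto intro!: open_INT open_coord_pred)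
qed

lemma closed_cylinder: "closed {a :: nat \<Rightarrow> nat. \<forall>i<l. a i = p i}"
proof -
  have "{a :: nat \<Rightarrow> nat. \<forall>i<l. a i = p i} = (\<Inter>i\<in>{..<l}. {a. a i = p i})" by auto
  then show ?thesis by (auto intro!: closed_INT closed_coord2)
qed

section \<open>Borel sets and finer Polish topologies\<close>

lemma borel_seq_sigma_sets:
  assumes "B \<in> sets (borel :: (nat \<Rightarrow> nat) measure)"
  shows "B \<in> sigma_sets UNIV {{f. f i \<in> A} |i A. i \<in> (UNIV :: nat set) \<and> A \<in> sets (borel :: nat measure)}"
proof -
  have "B \<in> sets (Pi\<^sub>M UNIV (\<lambda>_::nat. borel :: nat measure))"
    using assms by (simp add: sets_PiM_equal_borel)
  then show ?thesis
    by (simp add: sets_PiM_single PiE_UNIV_domain)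
qed
text \<open>A Borel map \<open>y\<close> resolves \<open>B\<close> if adjoining \<open>y x\<close> to \<open>x\<close> makes \<open>B\<close> clopen while the space
  stays Polish: the adjoined space is the graph of \<open>y\<close>, which is closed, and membership in \<open>B\<close> can be
  read off from one coordinate of \<open>y x\<close>.\<close>
definition resolves :: "((nat \<Rightarrow> nat) \<Rightarrow> nat \<Rightarrow> nat) \<Rightarrow> (nat \<Rightarrow> nat) set \<Rightarrow> bool" where
  "resolves y B \<longleftrightarrow> y \<in> borel_measurable borel \<and> closed {(x, w). w = y x} \<and>
     (\<forall>x. x \<in> B \<longleftrightarrow> y x 0 \<noteq> 0)"

lemma closed_graph_slice:
  fixes y :: "(nat \<Rightarrow> nat) \<Rightarrow> nat \<Rightarrow> nat"
  assumes "closed {(x, w). w = y x}"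
  shows "closed {(x, w). slice k w = y x}"
proof -
  have "closed ((\<lambda>(x, w). (x, slice k w)) -` {(x, w). w = y x})"
    unfolding case_prod_unfold
    by (rule closed_vimage[OF assms[unfolded case_prod_unfold]])
      (intro continuous_on_Pair continuous_on_slice continuous_on_fst continuous_on_snd continuous_on_id)
  then show ?thesis by (simp add: vimage_def case_prod_unfold)
qed

lemma UNIV_Times_eq: "UNIV \<times> S = {(x, w). w \<in> S}"
  by auto

lemma closed_snd: "closed S \<Longrightarrow> closed {(x :: nat \<Rightarrow> nat, w :: nat \<Rightarrow> nat). w \<in> S}"
  using closed_Times[OF closed_UNIV, of S] by (simp add: UNIV_Times_eq)

lemma closed_graph_continuous:
  fixes y :: "(nat \<Rightarrow> nat) \<Rightarrow> nat \<Rightarrow> nat"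
  assumes c: "continuous_on UNIV y"
  shows "closed {(x, w). w = y x}"
proof -
  have "continuous_on UNIV (\<lambda>z. y (fst z))" "continuous_on UNIV (\<lambda>z :: (nat \<Rightarrow> nat) \<times> (nat \<Rightarrow> nat). snd z)"
    by (rule continuous_on_compose2[OF c]) (auto intro: continuous_on_fst continuous_on_snd continuous_on_id)
  note c2 = this[THEN continuous_on_product_then_coordinatewise]
  have "closed {z. snd z i = y (fst z) i}" for i
    by (rule closed_Collect_eq[OF c2(2) c2(1)])
  then have "closed (\<Inter>i. {z. snd z i = y (fst z) i})" by blast
  moreover have "(\<Inter>i. {z. snd z i = y (fst z) i}) = {(x, w). w = y x}"
    by (auto simp: fun_eq_iff)
  ultimately show ?thesis by simp
qed

text \<open>Negating the first coordinate of \<open>y\<close> would lose information and with it the closedness of the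
  graph, so the old \<open>y\<close> is kept in the remaining rows.\<close>
lemma resolves_Compl:
  assumes "resolves y B"
  shows "\<exists>y'. resolves y' (- B)"
proof -
  define y' where "y' x = pack (case_nat (\<lambda>_. if y x 0 = 0 then 1 else 0) (\<lambda>_. y x))" for x
  have 1: "y' \<in> borel_measurable borel"
    unfolding y'_def using assms
    by (intro measurable_pack measurable_coordinatewise_then_product)
      (auto simp: resolves_def split: nat.split intro!: measurable_coord)
  have "{(x, w). w = y' x} = (\<Inter>k. {(x, w). slice (Suc k) w = y x}) \<inter>
      (\<Inter>i. {(x, w). w \<in> {w. w (prod_encode (0, i)) = (if w (prod_encode (1, 0)) = 0 then 1 else 0)}})"
    (is "?L = ?R")
  proof (intro set_eqI iffI)
    fix z assume "z \<in> ?L"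
    then obtain x where z: "z = (x, y' x)" by auto
    show "z \<in> ?R" 
      by (simp add: z) (auto simp: y'_def pack_def)
  next
    fix z assume z: "z \<in> ?R"
    obtain x w where zz: "z = (x, w)" by force
    have "slice k w = case_nat (\<lambda>_. if y x 0 = 0 then 1 else 0) (\<lambda>_. y x) k" for k
    proof (cases k)
      case 0
      have "slice 1 w 0 = y x 0" using z zz by auto
      then show ?thesis using z zz 0 by (auto simp: slice_def fun_eq_iff)
    next
      case (Suc m)
      then show ?thesis using z zz by auto
    qed
    then have "w = y' x" unfolding y'_def by (intro pack_eqI) 
    then show "z \<in> ?L" by (simp add: zz)
  qed
  moreover have "closed ?R"
    using assms by (intro closed_Int closed_INT ballI closed_graph_slice closed_snd closed_coord2)
      (auto simp: resolves_def)
  ultimately have 2: "closed {(x, w). w = y' x}" by metis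
  show ?thesis
    using 1 2 assms by (intro exI[of _ y']) (auto simp: resolves_def y'_def)
qed

text \<open>The new first coordinate names the least \<open>n\<close> with \<open>x \<in> B n\<close>, shifted by one, and is 0 if there
  is none.  Merely recording whether \<open>x\<close> lies in the union would not be enough: the graph is closed
  because both a bounded witness and the absence of all witnesses survive limits.\<close>
lemma resolves_UN:
  fixes B :: "nat \<Rightarrow> (nat \<Rightarrow> nat) set"
  assumes "\<And>n. resolves (y n) (B n)"
  shows "\<exists>y'. resolves y' (\<Union>n. B n)"
proof -
  define c where "c x = (if \<exists>n. y n x 0 \<noteq> 0 then Suc (LEAST n. y n x 0 \<noteq> 0) else 0)" for x
  define y' where "y' x = pack (case_nat (\<lambda>_. c x) (\<lambda>n. y n x))" for x
  have c0: "c x = 0 \<longleftrightarrow> (\<forall>n. y n x 0 = 0)" for x by (auto simp: c_def)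
  have cS: "c x = Suc m \<longleftrightarrow> y m x 0 \<noteq> 0 \<and> (\<forall>n<m. y n x 0 = 0)" for x m
  proof
    assume "c x = Suc m"
    then have e: "\<exists>n. y n x 0 \<noteq> 0" "m = (LEAST n. y n x 0 \<noteq> 0)" by (auto simp: c_def split: if_splits)
    show "y m x 0 \<noteq> 0 \<and> (\<forall>n<m. y n x 0 = 0)"
      using LeastI_ex[OF e(1)] not_less_Least e(2) by auto
  next
    assume a: "y m x 0 \<noteq> 0 \<and> (\<forall>n<m. y n x 0 = 0)"
    then have "(LEAST n. y n x 0 \<noteq> 0) = m"
      by (intro Least_equality) (auto simp flip: not_less)
    then show "c x = Suc m" using a by (auto simp: c_def)
  qed
  have [measurable]: "y n \<in> borel_measurable borel" for n using assms by (simp add: resolves_def)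
  have [measurable]: "c \<in> borel_measurable borel"
    unfolding c_def by measurable
  have 1: "y' \<in> borel_measurable borel"
    unfolding y'_def
    by (intro measurable_pack measurable_coordinatewise_then_product) (case_tac k; simp)
  have "{(x, w). w = y' x} = (\<Inter>k. {(x, w). slice (Suc k) w = y k x}) \<inter>
      (\<Inter>i. {(x, w). w \<in> {w. w (prod_encode (0, i)) = w (prod_encode (0, 0))}}) \<inter>
      (\<Inter>n. {(x, w). w \<in> {w. w (prod_encode (0, 0)) = 0 \<longrightarrow> w (prod_encode (Suc n, 0)) = 0}}) \<inter>
      (\<Inter>n. {(x, w). w \<in> {w. w (prod_encode (0, 0)) = Suc n \<longrightarrow> w (prod_encode (Suc n, 0)) \<noteq> 0}}) \<inter>
      (\<Inter>n. {(x, w). w \<in> {w. n < w (prod_encode (0, 0)) - 1 \<longrightarrow> w (prod_encode (Suc n, 0)) = 0}})"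
    (is "?L = ?R")
  proof (intro set_eqI iffI)
    fix z assume "z \<in> ?L"
    then obtain x where z: "z = (x, y' x)" by auto
    have p: "y' x (prod_encode (k, i)) = (case k of 0 \<Rightarrow> c x | Suc n \<Rightarrow> y n x i)" for k i
      by (simp add: y'_def pack_def split: nat.split)
    have "n < c x - 1 \<Longrightarrow> y n x 0 = 0" for n using cS[of x "c x - 1"] by (cases "c x") auto
    moreover have "slice (Suc k) (y' x) = y k x" for k by (simp add: y'_def)
    ultimately show "z \<in> ?R" using c0[of x] cS[of x]
      by (auto simp: z p)
  next
    fix z assume z: "z \<in> ?R"
    obtain x w where zz: "z = (x, w)" by force
    have r: "slice (Suc n) w = y n x" for n using z zz by auto
    have r0: "y n x 0 = w (prod_encode (Suc n, 0))" for n using r[of n] by (simp add: slice_def fun_eq_iff)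
    have "w (prod_encode (0, 0)) = c x"
    proof (cases "w (prod_encode (0, 0))")
      case 0
      then have "c x = 0" using z unfolding c0 zz r0 by auto
      then show ?thesis using 0 by simp
    next
      case (Suc m)
      then have "c x = Suc m" using z unfolding cS zz r0 by auto
      then show ?thesis using Suc by simp
    qed
    then have "slice k w = case_nat (\<lambda>_. c x) (\<lambda>n. y n x) k" for k
      using r z zz by (auto simp: slice_def fun_eq_iff split: nat.split)
    then have "w = y' x" unfolding y'_def by (intro pack_eqI) 
    then show "z \<in> ?L" by (simp add: zz)
  qed
  moreover have "closed ?R"
    using assms by (intro closed_Int closed_INT ballI closed_graph_slice closed_snd closed_coord2)
      (auto simp: resolves_def)
  ultimately have 2: "closed {(x, w). w = y' x}" by metis
  show ?thesis
  proof (intro exI)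
    have "x \<in> (\<Union>n. B n) \<longleftrightarrow> y' x 0 \<noteq> 0" for x
      using assms c0[of x] unfolding resolves_def by (simp add: y'_def)
    then show "resolves y' (\<Union>n. B n)" using 1 2 unfolding resolves_def by blast
  qed
qed

text \<open>The resolvable sets form a \<open>\<sigma>\<close>-algebra that contains the sets given by one coordinate.  This one
  fact provides both that Borel sets are projections of closed sets and that Borel sets can be made
  clopen.\<close>
lemma borel_resolvable:
  assumes "B \<in> sets (borel :: (nat \<Rightarrow> nat) measure)"
  shows "\<exists>y. resolves y B"
proof -
  from borel_seq_sigma_sets[OF assms] show ?thesis
  proof induction
    case (Basic B)
    then obtain i A where B: "B = {f. f i \<in> A}" by auto
    define y :: "(nat \<Rightarrow> nat) \<Rightarrow> nat \<Rightarrow> nat" where "y = (\<lambda>x _. if x i \<in> A then 1 else 0)"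
    have "continuous_on UNIV (\<lambda>n::nat. if n \<in> A then 1 else 0::nat)" by simp
    then have "continuous_on UNIV ((\<lambda>n::nat. if n \<in> A then 1 else 0::nat) \<circ> (\<lambda>w. w i))"
      by (intro continuous_on_compose[OF continuous_coord]) (auto intro: continuous_on_subset)
    then have c: "continuous_on UNIV y" unfolding y_def
      by (intro continuous_on_coordinatewise_then_product) (simp add: o_def)
    have "closed {(x, w). w = y x}" by (rule closed_graph_continuous[OF c])
    then have "resolves y B"
      using borel_measurable_continuous_onI[OF c] by (simp add: resolves_def B) (simp add: y_def)
    then show ?case by blast
  next
    case Empty
    have "closed {(x :: nat \<Rightarrow> nat, w :: nat \<Rightarrow> nat). w = (\<lambda>_. 0)}"
      by (rule closed_graph_continuous) (rule continuous_on_const)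
    then have "resolves (\<lambda>_ _. 0) {}" by (auto simp: resolves_def)
    then show ?case by blast
  next
    case (Compl a)
    then show ?case using resolves_Compl unfolding Compl_eq_Diff_UNIV by blast
  next
    case (Union a)
    then obtain y where "\<And>n. resolves (y n) (a n)" by metis
    then show ?case by (rule resolves_UN)
  qed
qed

section \<open>Separation of analytic sets\<close>

text \<open>The closed set lives in the space of pairs, coded by rows; the projection is \<open>slice 0\<close>.\<close>
definition analytic :: "(nat \<Rightarrow> nat) set \<Rightarrow> bool" where
  "analytic A \<longleftrightarrow> (\<exists>C. closed C \<and> A = slice 0 ` C)"

text \<open>The witness for \<open>x\<close> consists of a point \<open>v\<close> that codes a pair in \<open>B\<close> over \<open>x\<close>, together with
  the resolving sequence of \<open>v\<close>, which makes the condition closed.\<close>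
lemma analytic_fst:
  fixes B :: "((nat \<Rightarrow> nat) \<times> (nat \<Rightarrow> nat)) set"
  assumes "B \<in> sets (borel \<Otimes>\<^sub>M borel)"
  shows "analytic (fst ` B)"
proof -
  note [measurable] = assms
  have "{v \<in> space borel. (slice 0 v, slice 1 v) \<in> B} \<in> sets borel" by measurable
  then have "{v. (slice 0 v, slice 1 v) \<in> B} \<in> sets borel" by simp
  then obtain y where y: "resolves y {v. (slice 0 v, slice 1 v) \<in> B}"
    using borel_resolvable by blast
  define C where "C = (\<Inter>i. {u. u (prod_encode (1, prod_encode (0, i))) = u (prod_encode (0, i))}) \<inter>
    ((\<lambda>u. (slice 1 u, slice 2 u)) -` {(x, w). w = y x}) \<inter> {u. u (prod_encode (2, 0)) \<noteq> 0 }"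
  have "closed ((\<lambda>u. (slice 1 u, slice 2 u)) -` {(x, w). w = y x})"
    using y unfolding resolves_def
    by (intro closed_vimage continuous_on_Pair continuous_on_slice continuous_on_id) auto
  moreover have "closed {u :: nat \<Rightarrow> nat. u (prod_encode (2, 0)) \<noteq> 0 }" 
    by (rule closed_coord2[of "\<lambda>x _. x \<noteq> 0"])
  ultimately have "closed C"
    unfolding C_def by (intro closed_Int closed_INT ballI closed_coord2)
  moreover have "fst ` B = slice 0 ` C"
  proof (intro set_eqI iffI)
    fix x assume "x \<in> fst ` B"
    then obtain z where z: "(x, z) \<in> B" by auto
    define v where "v = pack (\<lambda>k. if k = 0 then x else z)"
    define u where "u = pack (\<lambda>k. if k = 0 then x else if k = 1 then v else y v)"
    have s: "slice 0 u = x" "slice 1 u = v" "slice 2 u = y v" "slice 0 v = x" "slice 1 v = z"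
      by (simp_all add: u_def v_def)
    have "y v 0 \<noteq> 0" using y z s by (auto simp: resolves_def)
    then have "u \<in> C" using s by (auto simp: C_def slice_def fun_eq_iff)
    then show "x \<in> slice 0 ` C" using s by blast
  next
    fix x assume "x \<in> slice 0 ` C"
    then obtain u where u: "u \<in> C" "x = slice 0 u" by auto
    have 1: "slice 0 (slice 1 u) = slice 0 u" "slice 2 u = y (slice 1 u)"
      using u(1) by (auto simp: C_def slice_def)
    moreover have "slice 2 u 0 \<noteq> 0"
      using u(1) unfolding C_def slice_def by blast
    ultimately have "y (slice 1 u) 0 \<noteq> 0" by metis
    then have "slice 1 u \<in> {v. (slice 0 v, slice 1 v) \<in> B}"
      using y by (auto simp: resolves_def)
    then show "x \<in> fst ` B" using 1 u by force
  qed
  ultimately show ?thesis unfolding analytic_def by blast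
qed

lemma branch_exists:
  assumes "Q []" and step: "\<And>s. Q s \<Longrightarrow> \<exists>k. Q (s @ [k])"
  shows "\<exists>v. \<forall>j. Q (map v [0..<j])"
proof -
  define e where "e s = (SOME k. Q (s @ [k]))" for s
  define t where "t j = ((\<lambda>s. s @ [e s]) ^^ j) []" for j
  have Q: "Q (t j)" for j
    by (induction j) (use assms someI_ex[OF step] in \<open>auto simp: t_def e_def\<close>)
  have "t j = map (\<lambda>i. e (t i)) [0..<j]" for j
    by (induction j) (auto simp: t_def)
  then have "\<forall>j. Q (map (\<lambda>i. e (t i)) [0..<j])" using Q by metis
  then show ?thesis by blast
qed

text \<open>Suppose that the sets cannot be separated.  Splitting one of them into countably many pieces
  leaves one piece for which this persists, since separating families for all pieces could be combined.
  Refining codes of points of all \<open>A n\<close> digit by digit, in one enumeration of all digits, yields a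
  point \<open>z n\<close> of each \<open>A n\<close> in the limit.  As the intersection is empty, two of these points differ
  in some coordinate, and that coordinate separates the pieces at a finite stage.\<close>
theorem novikov_separation:
  assumes an: "\<And>n. analytic (A n)" and emp: "(\<Inter>n::nat. A n) = {}"
  shows "\<exists>Q. (\<forall>n. Q n \<in> sets borel \<and> A n \<subseteq> Q n) \<and> (\<Inter>n. Q n) = {}"
proof (rule ccontr)
  define sep where "sep P \<longleftrightarrow> (\<exists>Q. (\<forall>n. Q n \<in> sets borel \<and> P n \<subseteq> Q n) \<and> (\<Inter>n. Q n) = {})"
    for P :: "nat \<Rightarrow> (nat \<Rightarrow> nat) set"
  assume "\<not> ?thesis"
  then have nsep: "\<not> sep A" by (simp add: sep_def)
  obtain E where E: "\<And>n. closed (E n)" "\<And>n. A n = slice 0 ` E n"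
    using an unfolding analytic_def by metis
  \<comment> \<open>The string \<open>s\<close> prescribes digits of codes for all sets at once: position \<open>prod_encode (n, i)\<close>
      belongs to digit \<open>i\<close> of the code for \<open>A n\<close>, so one more letter refines exactly one of the sets.\<close>
  define P where "P s n = slice 0 ` {u \<in> E n. \<forall>i. prod_encode (n, i) < length s \<longrightarrow> u i = s ! prod_encode (n, i)}"
    for s n
  have P0: "P [] = A" by (auto simp: P_def E fun_eq_iff)
  have step: "\<exists>k. \<not> sep (P (s @ [k]))" if "\<not> sep (P s)" for s
  proof (rule ccontr)
    assume "\<nexists>k. \<not> sep (P (s @ [k]))"
    then have "\<forall>k. \<exists>Q. (\<forall>n. Q n \<in> sets borel \<and> P (s @ [k]) n \<subseteq> Q n) \<and> (\<Inter>n. Q n) = {}"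
      by (simp add: sep_def)
    then obtain Q where Q: "\<And>k n. Q k n \<in> sets borel" "\<And>k n. P (s @ [k]) n \<subseteq> Q k n"
      "\<And>k. (\<Inter>n. Q k n) = {}" by metis
    obtain n0 i0 where n0: "length s = prod_encode (n0, i0)"
      by (metis prod_decode_inverse surj_pair)
    have eq: "P (s @ [k]) n = P s n" if "n \<noteq> n0" for k n
    proof -
      have "(prod_encode (n, i) < length (s @ [k]) \<longrightarrow> u i = (s @ [k]) ! prod_encode (n, i)) \<longleftrightarrow>
        (prod_encode (n, i) < length s \<longrightarrow> u i = s ! prod_encode (n, i))" for u :: "nat \<Rightarrow> nat" and i
      proof -
        have "prod_encode (n, i) \<noteq> length s" using that n0 by simp
        then show ?thesis by (simp add: nth_append less_Suc_eq)
      qed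
      then show ?thesis unfolding P_def by presburger
    qed
    have sub: "P s n0 \<subseteq> (\<Union>k. P (s @ [k]) n0)"
    proof
      fix x assume "x \<in> P s n0"
      then obtain u where u: "u \<in> E n0" "x = slice 0 u"
        "\<And>i. prod_encode (n0, i) < length s \<Longrightarrow> u i = s ! prod_encode (n0, i)"
        by (auto simp: P_def)
      have "u i = (s @ [u i0]) ! prod_encode (n0, i)"
        if "prod_encode (n0, i) < length (s @ [u i0])" for i
        using that u(3)[of i] n0 by (cases "i = i0") (auto simp: nth_append less_Suc_eq)
      then have "x \<in> P (s @ [u i0]) n0" using u by (auto simp: P_def)
      then show "x \<in> (\<Union>k. P (s @ [k]) n0)" by blast
    qed
    define R where "R n = (if n = n0 then \<Union>k. Q k n0 else \<Inter>k. Q k n)" for n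
    have "P s n \<subseteq> R n" for n
      using sub Q(2) eq[of n] by (cases "n = n0") (auto simp: R_def, blast+)
    moreover have "R n \<in> sets borel" for n
      unfolding R_def using Q(1) by auto
    moreover have "(\<Inter>n. R n) = {}"
    proof -
      have "x \<notin> (\<Inter>n. R n)" for x
      proof
        assume x: "x \<in> (\<Inter>n. R n)"
        then have "x \<in> R n0" by blast
        then obtain k where k: "x \<in> Q k n0" by (auto simp: R_def)
        have "x \<in> Q k n" for n using k x by (cases "n = n0") (auto simp: R_def split: if_splits)
        then show False using Q(3)[of k] by blast
      qed
      then show ?thesis by blast
    qed
    ultimately have "sep (P s)" unfolding sep_def by blast
    then show False using that by blast
  qed
  have "\<exists>v. \<forall>j. \<not> sep (P (map v [0..<j]))"
    by (rule branch_exists[of "\<lambda>s. \<not> sep (P s)"]) (use step nsep P0 in auto)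
  then obtain v where v: "\<And>j. \<not> sep (P (map v [0..<j]))" by blast
  have zE: "slice n v \<in> E n" for n
  proof (rule ccontr)
    assume "slice n v \<notin> E n"
    then obtain l where l: "\<And>a. \<forall>i<l. a i = slice n v i \<Longrightarrow> a \<notin> E n"
      using open_imp_cylinder[of "- E n" "slice n v"] E(1) by auto
    obtain j where j: "\<And>i. i < l \<Longrightarrow> prod_encode (n, i) < j"
      using finite_nat_bounded[of "(\<lambda>i. prod_encode (n, i)) ` {..<l}"] by auto
    have "P (map v [0..<j]) n = {}"
      using l j unfolding P_def slice_def by fastforce
    then have "sep (P (map v [0..<j]))"
      unfolding sep_def by (intro exI[of _ "\<lambda>k. if k = n then {} else UNIV"]) auto
    then show False using v by blast
  qed
  show False
  proof (cases "\<forall>n. slice 0 (slice n v) = slice 0 (slice 0 v)")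
    case True
    then have "slice 0 (slice 0 v) \<in> A n" for n using zE[of n] E(2)[of n] by (metis imageI)
    then show False using emp by blast
  next
    case False
    then obtain n i where i: "slice 0 (slice n v) i \<noteq> slice 0 (slice 0 v) i"
      by (meson ext)
    define c where "c = prod_encode (0, i)"
    have ne: "slice n v c \<noteq> slice 0 v c" using i by (simp add: slice_def c_def)
    define j where "j = Suc (prod_encode (n, c) + prod_encode (0, c))"
    have sub: "P (map v [0..<j]) m \<subseteq> {x. x i = slice m v c}" if "m \<in> {0, n}" for m
    proof
      fix x assume "x \<in> P (map v [0..<j]) m"
      then obtain u where u: "x = slice 0 u"
        "\<And>k. prod_encode (m, k) < j \<Longrightarrow> u k = map v [0..<j] ! prod_encode (m, k)"
        by (auto simp: P_def)
      have "prod_encode (m, c) < j" using that by (auto simp: j_def)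
      then have "u c = slice m v c" using u(2)[of c] by (simp add: slice_def)
      then show "x \<in> {x. x i = slice m v c}" using u(1) by (simp add: slice_def c_def)
    qed
    have bor: "{x :: nat \<Rightarrow> nat. x i = a} \<in> sets borel" for a
      using open_coord_pred[of "\<lambda>x. x = a" i] by auto
    define R where "R m = (if m \<in> {0, n} then {x. x i = slice m v c} else UNIV)" for m
    have "R m \<in> sets borel \<and> P (map v [0..<j]) m \<subseteq> R m" for m
      using sub[of m] bor by (simp add: R_def)
    moreover have "(\<Inter>m. R m) = {}"
    proof (intro equals0I)
      fix x assume "x \<in> (\<Inter>m. R m)"
      then have "x \<in> R 0" "x \<in> R n" by blast+
      then show False using ne by (simp add: R_def)
    qed
    ultimately have "sep (P (map v [0..<j]))" unfolding sep_def by blast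
    then show False using v by blast
  qed
qed

corollary lusin_separation:
  assumes "analytic A" "analytic B" "A \<inter> B = {}"
  shows "\<exists>D. D \<in> sets borel \<and> A \<subseteq> D \<and> B \<inter> D = {}"
proof -
  have "(\<Inter>n. case_nat A (\<lambda>_. B) n) = {}" 
  proof (intro equals0I)
    fix x assume "x \<in> (\<Inter>n. case_nat A (\<lambda>_. B) n)"
    then have "x \<in> case_nat A (\<lambda>_. B) 0" "x \<in> case_nat A (\<lambda>_. B) 1" by blast+
    then show False using assms(3) by auto
  qed
  moreover have "analytic (case_nat A (\<lambda>_. B) n)" for n using assms by (cases n) auto
  ultimately obtain Q where Q: "\<And>n. Q n \<in> sets borel" "\<And>n. case_nat A (\<lambda>_. B) n \<subseteq> Q n" "(\<Inter>n. Q n) = {}"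
    using novikov_separation[of "case_nat A (\<lambda>_. B)"] by blast
  have "A \<subseteq> Q 0" using Q(2)[of 0] by simp
  moreover have "B \<subseteq> Q (Suc n)" for n using Q(2)[of "Suc n"] by simp
  then have "B \<inter> Q 0 = {}"
  proof (intro equals0I)
    fix x assume x: "x \<in> B \<inter> Q 0"
    have "x \<in> Q n" for n using x \<open>\<And>n. B \<subseteq> Q (Suc n)\<close> by (cases n) auto
    then show False using Q(3) by blast
  qed
  ultimately show ?thesis using Q(1) by blast
qed

section \<open>Borel relations with finite sections\<close>

text \<open>The projections of \<open>{z \<in> B. snd z n = v}\<close> and of its complement in \<open>B\<close> are disjoint, since each
  section has at most one point.  Borel sets that separate them decide the coordinates of the value
  and thereby define a Borel map on the whole space.\<close>
lemma borel_uniformization_unique: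
  fixes B :: "((nat \<Rightarrow> nat) \<times> (nat \<Rightarrow> nat)) set"
  assumes B[measurable]: "B \<in> sets (borel \<Otimes>\<^sub>M borel)"
    and uniq: "\<And>x y y'. (x, y) \<in> B \<Longrightarrow> (x, y') \<in> B \<Longrightarrow> y = y'"
  shows "\<exists>g. g \<in> borel_measurable borel \<and> (\<forall>(x, y) \<in> B. y = g x)"
proof -
  have "\<exists>D. D \<in> sets borel \<and> fst ` {z \<in> B. snd z n = v} \<subseteq> D \<and> fst ` {z \<in> B. snd z n \<noteq> v} \<inter> D = {}"
    for n and v :: nat
  proof (rule lusin_separation)
    have "{z \<in> space (borel \<Otimes>\<^sub>M borel). z \<in> B \<and> snd z n = v} \<in> sets (borel \<Otimes>\<^sub>M borel)" by measurable
    then show "analytic (fst ` {z \<in> B. snd z n = v})" 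
      by (intro analytic_fst) (simp add: space_pair_measure)
    have "{z \<in> space (borel \<Otimes>\<^sub>M borel). z \<in> B \<and> snd z n \<noteq> v} \<in> sets (borel \<Otimes>\<^sub>M borel)" by measurable
    then show "analytic (fst ` {z \<in> B. snd z n \<noteq> v})"
      by (intro analytic_fst) (simp add: space_pair_measure)
    show "fst ` {z \<in> B. snd z n = v} \<inter> fst ` {z \<in> B. snd z n \<noteq> v} = {}" using uniq by fastforce
  qed
  then have "\<exists>D. \<forall>n v. D n v \<in> sets borel \<and> fst ` {z \<in> B. snd z n = v} \<subseteq> D n v \<and>
      fst ` {z \<in> B. snd z n \<noteq> v} \<inter> D n v = {}"
    by (intro choice allI)
  then obtain D where D: "\<forall>n v. D n v \<in> sets borel \<and> fst ` {z \<in> B. snd z n = v} \<subseteq> D n v \<and>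
      fst ` {z \<in> B. snd z n \<noteq> v} \<inter> D n v = {}" ..
  have [measurable]: "D n v \<in> sets borel" for n v using D by simp
  have D1: "fst ` {z \<in> B. snd z n = v} \<subseteq> D n v" for n v using D by simp
  have D2: "fst ` {z \<in> B. snd z n \<noteq> v} \<inter> D n v = {}" for n v using D by simp
  define g where "g x n = (LEAST v. x \<in> D n v)" for x n
  have "(\<lambda>x. LEAST v. x \<in> D n v) \<in> borel_measurable borel" for n
    supply measurable_coord [measurable del] by (rule borel_measurable_into_nat) measurable
  then have "g \<in> borel_measurable borel"
    by (intro measurable_coordinatewise_then_product) (simp add: g_def)
  moreover have "y = g x" if "(x, y) \<in> B" for x y
  proof
    fix n
    have "x \<in> D n (y n)" using D1[of n "y n"] that by force
    moreover have "x \<notin> D n v" if "v \<noteq> y n" for v using D2[of n v] that \<open>(x, y) \<in> B\<close> by force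
    ultimately show "y n = g x n" unfolding g_def by (metis (mono_tags, lifting) LeastI)
  qed
  ultimately show ?thesis by blast
qed

text \<open>A finite section is separated by its prefixes of some length \<open>m\<close>.  The sets \<open>S m\<close> of
  points where length \<open>m\<close> does not suffice are analytic with empty intersection.  Novikov separation
  replaces them by Borel sets, still with empty intersection; off the \<open>m\<close>-th one, fixing a prefix of
  length \<open>m\<close> cuts \<open>B\<close> down to sections with at most one point.\<close>
theorem finite_sections_uniformization:
  fixes B :: "((nat \<Rightarrow> nat) \<times> (nat \<Rightarrow> nat)) set"
  assumes B[measurable]: "B \<in> sets (borel \<Otimes>\<^sub>M borel)"
    and fin: "\<And>x. finite {y. (x, y) \<in> B}"
  shows "\<exists>D g. (\<forall>k :: nat. D k \<in> sets borel \<and> g k \<in> borel_measurable borel) \<and>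
           B = (\<Union>k. {(x, g k x) |x. x \<in> D k})"
proof -
  define S where "S m = fst ` {z \<in> space (borel \<Otimes>\<^sub>M borel). (fst z, slice 0 (snd z)) \<in> B \<and>
      (fst z, slice 1 (snd z)) \<in> B \<and> (\<exists>i. slice 0 (snd z) i \<noteq> slice 1 (snd z) i) \<and>
      (\<forall>i<m. slice 0 (snd z) i = slice 1 (snd z) i)}" for m
  have S: "x \<in> S m \<longleftrightarrow> (\<exists>y y'. (x, y) \<in> B \<and> (x, y') \<in> B \<and> y \<noteq> y' \<and> (\<forall>i<m. y i = y' i))" for x m
  proof
    assume "x \<in> S m"
    then show "\<exists>y y'. (x, y) \<in> B \<and> (x, y') \<in> B \<and> y \<noteq> y' \<and> (\<forall>i<m. y i = y' i)"
      by (auto simp: S_def space_pair_measure fun_eq_iff)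
  next
    assume "\<exists>y y'. (x, y) \<in> B \<and> (x, y') \<in> B \<and> y \<noteq> y' \<and> (\<forall>i<m. y i = y' i)"
    then obtain y y' where "(x, y) \<in> B" "(x, y') \<in> B" "y \<noteq> y'" "\<forall>i<m. y i = y' i" by blast
    then show "x \<in> S m"
      unfolding S_def
      by (intro image_eqI[of _ _ "(x, pack (\<lambda>k. if k = 0 then y else y'))"])
        (auto simp: space_pair_measure fun_eq_iff)
  qed
  have "analytic (S m)" for m unfolding S_def by (rule analytic_fst) measurable
  moreover have "(\<Inter>m. S m) = {}"
  proof (rule ccontr)
    assume "(\<Inter>m. S m) \<noteq> {}"
    then obtain x where x: "\<And>m. x \<in> S m" by blast
    define F where "F = {(y, y'). (x, y) \<in> B \<and> (x, y') \<in> B \<and> y \<noteq> y'}"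
    have "finite F" 
      by (rule finite_subset[of _ "{y. (x, y) \<in> B} \<times> {y. (x, y) \<in> B}"]) (auto simp: F_def fin)
    have "\<forall>z\<in>F. \<exists>i. fst z i \<noteq> snd z i" by (auto simp: F_def fun_eq_iff)
    then obtain d where d: "\<And>z. z \<in> F \<Longrightarrow> fst z (d z) \<noteq> snd z (d z)" by metis
    obtain m where "d ` F \<subseteq> {..<m}" 
      using finite_nat_bounded \<open>finite F\<close> by blast
    then have m: "\<And>z. z \<in> F \<Longrightarrow> d z < m" by auto
    obtain y y' where "(y, y') \<in> F" "\<forall>i<m. y i = y' i" using x[of m] unfolding S F_def by blast
    then show False using d m by fastforce
  qed
  ultimately obtain Q where Q[measurable]: "\<And>m. Q m \<in> sets borel" and SQ: "\<And>m. S m \<subseteq> Q m"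
    and Q0: "(\<Inter>m. Q m) = {}" using novikov_separation[of S] by blast
  define C where "C t = {z \<in> space (borel \<Otimes>\<^sub>M borel). z \<in> B \<and> fst z \<notin> Q (length t) \<and> (\<forall>i<length t. snd z i = t ! i)}"
    for t :: "nat list"
  have C[measurable]: "C t \<in> sets (borel \<Otimes>\<^sub>M borel)" for t unfolding C_def by measurable
  have "\<exists>g. g \<in> borel_measurable borel \<and> (\<forall>(x, y) \<in> C t. y = g x)" for t
  proof (rule borel_uniformization_unique[OF C])
    fix x y y' assume "(x, y) \<in> C t" "(x, y') \<in> C t"
    then have "(x, y) \<in> B \<and> (x, y') \<in> B \<and> (\<forall>i<length t. y i = y' i)" "x \<notin> S (length t)"
      using SQ[of "length t"] by (auto simp: C_def)
    then show "y = y'" unfolding S by blast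
  qed
  then have "\<exists>g. \<forall>t. g t \<in> borel_measurable borel \<and> (\<forall>(x, y) \<in> C t. y = g t x)"
    by (intro choice allI)
  then obtain g where gt: "\<forall>t. g t \<in> borel_measurable borel \<and> (\<forall>(x, y) \<in> C t. y = g t x)" ..
  have g[measurable]: "g t \<in> borel_measurable borel" for t using gt by simp
  have gC: "y = g t x" if "(x, y) \<in> C t" for t x y using gt that by auto
  define D where "D t = {x \<in> space borel. (x, g t x) \<in> C t}" for t
  have D: "D t \<in> sets borel" for t unfolding D_def by measurable
  have "B = (\<Union>t. {(x, g t x) |x. x \<in> D t})"
  proof (intro set_eqI iffI)
    fix z assume "z \<in> B"
    moreover obtain x y where z: "z = (x, y)" by force
    obtain m where "x \<notin> Q m" using Q0 by blast
    ultimately have "(x, y) \<in> C (map y [0..<m])" by (simp add: C_def space_pair_measure z)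
    moreover from this have "y = g (map y [0..<m]) x" by (rule gC)
    ultimately show "z \<in> (\<Union>t. {(x, g t x) |x. x \<in> D t})" unfolding D_def z by force
  qed (auto simp: D_def C_def)
  also have "\<dots> = (\<Union>k :: nat. {(x, g (from_nat k) x) |x. x \<in> D (from_nat k)})"
    by auto (metis from_nat_to_nat)
  finally show ?thesis using D g by (intro exI[of _ "\<lambda>k. D (from_nat k)"] exI[of _ "\<lambda>k. g (from_nat k)"]) auto
qed

text \<open>If \<open>(x, y)\<close> is covered by the map \<open>g k\<close>, then \<open>(y, x)\<close> is covered by some \<open>g l\<close>, which is a
  left inverse of \<open>g k\<close> at \<open>x\<close>.  Cutting the domains according to \<open>l\<close> makes all maps injective with
  Borel left inverses.\<close>
corollary sym_finite_sections_injections: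
  fixes B :: "((nat \<Rightarrow> nat) \<times> (nat \<Rightarrow> nat)) set"
  assumes B: "B \<in> sets (borel \<Otimes>\<^sub>M borel)" and "sym B"
    and fin: "\<And>x. finite {y. (x, y) \<in> B}"
  shows "\<exists>D g g'. (\<forall>k :: nat. D k \<in> sets borel \<and> g k \<in> borel_measurable borel \<and>
            g' k \<in> borel_measurable borel \<and> (\<forall>x\<in>D k. g' k (g k x) = x)) \<and>
           B = (\<Union>k. {(x, g k x) |x. x \<in> D k})"
proof -
  from finite_sections_uniformization[OF B fin] obtain D g
    where Dg: "(\<forall>k :: nat. D k \<in> sets borel \<and> g k \<in> borel_measurable borel) \<and>
      B = (\<Union>k. {(x, g k x) |x. x \<in> D k})" by (elim exE)
  have D[measurable]: "D k \<in> sets borel" and g[measurable]: "g k \<in> borel_measurable borel" for k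
    using Dg by simp_all
  have BD: "B = (\<Union>k. {(x, g k x) |x. x \<in> D k})" using Dg by simp
  define i j where "i n = fst (prod_decode n)" and "j n = snd (prod_decode n)" for n
  define D' where "D' n = {x \<in> space borel. x \<in> D (i n) \<and> (\<forall>m. g (j n) (g (i n) x) m = x m)}" for n
  have "D' n \<in> sets borel" for n unfolding D'_def by measurable
  moreover have D'i: "g (j n) (g (i n) x) = x" if "x \<in> D' n" for n x
    using that by (auto simp: D'_def)
  moreover have "B = (\<Union>n. {(x, g (i n) x) |x. x \<in> D' n})"
  proof (intro set_eqI iffI)
    fix z assume z: "z \<in> B"
    then obtain k x where k: "z = (x, g k x)" "x \<in> D k" using BD by auto
    have "(g k x, x) \<in> B" using z k \<open>sym B\<close> by (auto simp: sym_def)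
    then obtain l where "x = g l (g k x)" using BD by auto
    then have "x \<in> D' (prod_encode (k, l))" "i (prod_encode (k, l)) = k"
      using k by (simp_all add: D'_def i_def j_def) 
    then show "z \<in> (\<Union>n. {(x, g (i n) x) |x. x \<in> D' n})" unfolding k by force
  qed (use BD in \<open>auto simp: D'_def\<close>)
  ultimately show ?thesis
    by (intro exI[of _ D'] exI[of _ "\<lambda>n. g (i n)"] exI[of _ "\<lambda>n. g (j n)"]) auto
qed

section \<open>Standard Borel spaces as Borel sets of sequences\<close>

lemma dyadic_floor_limit:
  fixes a :: real
  assumes "0 \<le> a"
  shows "(\<lambda>m. real (nat \<lfloor>2 ^ m * a\<rfloor>) / 2 ^ m) \<longlonglongrightarrow> a"
proof (rule real_tendsto_sandwich)
  have "(\<lambda>m. a - (1 / 2) ^ m) \<longlonglongrightarrow> a - 0"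
    by (intro tendsto_intros LIMSEQ_power_zero) simp
  then show "(\<lambda>m. a - (1 / 2) ^ m) \<longlonglongrightarrow> a" by simp
  have e: "real (nat \<lfloor>2 ^ m * a\<rfloor>) = of_int \<lfloor>2 ^ m * a\<rfloor>" for m using assms by simp
  have "2 ^ m * a - 1 \<le> of_int \<lfloor>2 ^ m * a\<rfloor>" for m by linarith
  then have "(2 ^ m * a - 1) / 2 ^ m \<le> of_int \<lfloor>2 ^ m * a\<rfloor> / 2 ^ m" for m
    by (intro divide_right_mono) auto
  moreover have "(2 ^ m * a - 1) / 2 ^ m = a - (1 / 2) ^ m" for m
    by (simp add: diff_divide_distrib power_one_over)
  ultimately have "a - (1 / 2) ^ m \<le> real (nat \<lfloor>2 ^ m * a\<rfloor>) / 2 ^ m" for m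
    unfolding e by metis
  then show "\<forall>\<^sub>F m in sequentially. a - (1 / 2) ^ m \<le> real (nat \<lfloor>2 ^ m * a\<rfloor>) / 2 ^ m" by simp
  have "of_int \<lfloor>2 ^ m * a\<rfloor> \<le> 2 ^ m * a" for m by simp
  then have "real (nat \<lfloor>2 ^ m * a\<rfloor>) / 2 ^ m \<le> a" for m
    unfolding e by (simp add: field_simps)
  then show "\<forall>\<^sub>F m in sequentially. real (nat \<lfloor>2 ^ m * a\<rfloor>) / 2 ^ m \<le> a" by simp
qed simp

text \<open>A point is determined by its distances to a countable dense set, and these are recorded by
  integer parts of dyadic multiples.  Completeness makes the image Borel: a function on the dense set is
  the distance to a point if and only if it satisfies both triangle inequalities and has infimum 0,
  because points where it is small then form a Cauchy sequence.\<close>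
theorem standard_borel_embedding:
  assumes X: "standard_borel_space X" and ne: "space X \<noteq> {}"
  shows "\<exists>\<iota> :: 'a \<Rightarrow> nat \<Rightarrow> nat. \<iota> \<in> borel_measurable X \<and> inj_on \<iota> (space X) \<and>
           (\<forall>S\<in>sets X. \<iota> ` S \<in> sets borel)"
proof -
  obtain T where T: "completely_metrizable_space T" "separable_space T" "topspace T = space X"
    "sets X = sigma_sets (topspace T) {U. openin T U}"
    using X unfolding standard_borel_space_def by blast
  obtain M d where Md: "Metric_space M d" "Metric_space.mcomplete M d" "T = Metric_space.mtopology M d"
    using T(1) unfolding completely_metrizable_space_def by blast
  interpret Metric_space M d by (rule Md(1))
  have M: "space X = M" using T(3) Md(3) by simp
  have openX: "U \<in> sets X" if "openin mtopology U" for U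
    using that T(4) Md(3) by auto
  obtain C where C: "countable C" "C \<subseteq> M" "mtopology closure_of C = M"
    using T(2) Md(3) unfolding separable_space_def by auto
  have "C \<noteq> {}" using C(3) ne M by auto
  define e where "e = from_nat_into C"
  have e: "range e = C" unfolding e_def by (rule range_from_nat_into[OF \<open>C \<noteq> {}\<close> C(1)])
  have eM: "e k \<in> M" for k using e C(2) by blast
  have dense: "\<exists>k. d x (e k) < r" if "x \<in> M" "r > 0" for x r
  proof -
    have "x \<in> mtopology closure_of C" using that C(3) by simp
    then obtain y where "y \<in> C" "y \<in> mball x r" using \<open>r > 0\<close> by (auto simp: metric_closure_of)
    then show ?thesis using e by (auto simp: image_iff)
  qed
  define \<iota> where "\<iota> x = pack (\<lambda>k m. nat \<lfloor>2 ^ m * d x (e k)\<rfloor>)" for x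
  \<comment> \<open>The real distances are recovered from the code as limits, hence measurably.\<close>
  define \<rho> where "\<rho> k p = lim (\<lambda>m. real (p (prod_encode (k, m))) / 2 ^ m)" for k and p :: "nat \<Rightarrow> nat"
  have \<rho>\<iota>: "\<rho> k (\<iota> x) = d x (e k)" for k x
    unfolding \<rho>_def \<iota>_def pack_def prod_encode_inverse prod.case
    by (rule limI[OF dyadic_floor_limit]) (rule nonneg)
  have [measurable]: "(\<lambda>p :: nat \<Rightarrow> nat. real (p i)) \<in> borel_measurable borel" for i
    by (rule measurable_compose[OF measurable_coord_count[of "\<lambda>p. p"]]) auto
  have \<rho>m[measurable]: "\<rho> k \<in> borel_measurable borel" for k
    unfolding \<rho>_def by (rule borel_measurable_lim_metric) measurable
  define K where "K = {p \<in> space borel. (\<forall>m. \<exists>k. \<rho> k p < 1 / real (Suc m)) \<and>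
      (\<forall>k j. \<bar>\<rho> k p - \<rho> j p\<bar> \<le> d (e k) (e j) \<and> d (e k) (e j) \<le> \<rho> k p + \<rho> j p) \<and>
      (\<forall>k m. real (p (prod_encode (k, m))) = real (nat \<lfloor>2 ^ m * \<rho> k p\<rfloor>))}"
  have Km: "K \<in> sets borel" unfolding K_def by measurable
  have \<iota>M: "\<iota> ` M = K"
  proof (intro equalityI subsetI)
    fix p assume "p \<in> \<iota> ` M"
    then obtain x where x: "x \<in> M" "p = \<iota> x" by blast
    have "\<iota> x (prod_encode (k, m)) = nat \<lfloor>2 ^ m * d x (e k)\<rfloor>" for k m by (simp add: \<iota>_def pack_def)
    moreover have "\<bar>d x (e k) - d x (e j)\<bar> \<le> d (e k) (e j)" for k j
      using triangle[of x "e k" "e j"] triangle[of x "e j" "e k"] x(1) eM commute[of "e k" "e j"] by (simp add: abs_le_iff)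
    moreover have "d (e k) (e j) \<le> d x (e k) + d x (e j)" for k j
      using triangle[of "e k" x "e j"] x(1) eM commute[of "e k" x] by simp
    ultimately show "p \<in> K" unfolding K_def x(2) using dense[OF x(1)] by (simp add: \<rho>\<iota>)
  next
    fix p assume p: "p \<in> K"
    have p1: "\<exists>k. \<rho> k p < 1 / real (Suc m)" for m using p unfolding K_def by blast
    have p2: "\<bar>\<rho> k p - \<rho> j p\<bar> \<le> d (e k) (e j)" "d (e k) (e j) \<le> \<rho> k p + \<rho> j p" for k j
      using p unfolding K_def by blast+
    have p3: "p (prod_encode (k, m)) = nat \<lfloor>2 ^ m * \<rho> k p\<rfloor>" for k m
      using p unfolding K_def of_nat_eq_iff by blast
    obtain \<kappa> where \<kappa>: "\<And>m. \<rho> (\<kappa> m) p < 1 / real (Suc m)" using p1 by metis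
    define \<sigma> where "\<sigma> m = e (\<kappa> m)" for m
    have \<sigma>d: "\<bar>d (\<sigma> m) (e j) - \<rho> j p\<bar> \<le> 1 / real (Suc m)" for m j
      using p2[of "\<kappa> m" j] \<kappa>[of m] unfolding \<sigma>_def by linarith
    have "MCauchy \<sigma>"
      unfolding MCauchy_def
    proof (intro conjI allI impI)
      show "range \<sigma> \<subseteq> M" using eM by (auto simp: \<sigma>_def)
      fix \<epsilon> :: real assume "\<epsilon> > 0"
      then obtain N where N: "1 / real (Suc N) < \<epsilon> / 2" using nat_approx_posE[of "\<epsilon> / 2"] by auto
      have "d (\<sigma> n) (\<sigma> n') < \<epsilon>" if "N \<le> n" "N \<le> n'" for n n'
      proof -
        have "1 / real (Suc n) \<le> 1 / real (Suc N)" "1 / real (Suc n') \<le> 1 / real (Suc N)"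
          using that by (simp_all add: frac_le)
        then show ?thesis using p2(2)[of "\<kappa> n" "\<kappa> n'"] \<kappa>[of n] \<kappa>[of n'] N unfolding \<sigma>_def by linarith
      qed
      then show "\<exists>N. \<forall>n n'. N \<le> n \<longrightarrow> N \<le> n' \<longrightarrow> d (\<sigma> n) (\<sigma> n') < \<epsilon>" by blast
    qed
    then obtain x where x: "limitin mtopology \<sigma> x sequentially"
      using Md(2) unfolding mcomplete_def by blast
    then have xM: "x \<in> M" by (simp add: limitin_mspace)
    have "d x (e j) = \<rho> j p" for j
    proof -
      have "(\<lambda>m. d (\<sigma> m) x) \<longlonglongrightarrow> 0" using x by (simp add: limitin_metric_dist_null)
      moreover have "(\<lambda>m. 1 / real (Suc m)) \<longlonglongrightarrow> 0" by (rule LIMSEQ_Suc[OF lim_1_over_n])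
      ultimately have "(\<lambda>m. d (\<sigma> m) x + 1 / real (Suc m)) \<longlonglongrightarrow> 0 + 0" by (rule tendsto_add)
      moreover have "\<bar>d x (e j) - \<rho> j p\<bar> \<le> d (\<sigma> m) x + 1 / real (Suc m)" for m
      proof -
        have "\<sigma> m \<in> M" using eM by (simp add: \<sigma>_def)
        then show ?thesis
          using \<sigma>d[of m j] triangle[of x "\<sigma> m" "e j"] triangle[of "\<sigma> m" x "e j"] xM eM[of j] commute[of x "\<sigma> m"]
          by linarith
      qed
      ultimately have "\<bar>d x (e j) - \<rho> j p\<bar> \<le> 0"
        by (intro tendsto_lowerbound[of "\<lambda>m. d (\<sigma> m) x + 1 / real (Suc m)" 0 sequentially]) auto
      then show ?thesis by simp
    qed
    then have "\<iota> x = p"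
      unfolding \<iota>_def by (intro pack_eqI[symmetric]) (simp add: slice_def p3)
    then show "p \<in> \<iota> ` M" using xM by blast
  qed
  have inj: "inj_on \<iota> M"
  proof (rule inj_onI)
    fix x y assume xy: "x \<in> M" "y \<in> M" "\<iota> x = \<iota> y"
    have eq: "d x (e k) = d y (e k)" for k using \<rho>\<iota>[of k x] \<rho>\<iota>[of k y] xy(3) by simp
    show "x = y"
    proof (rule ccontr)
      assume "x \<noteq> y"
      then have "d x y > 0" using xy by simp
      then obtain k where "d x (e k) < d x y / 2" using dense[of x "d x y / 2"] xy by auto
      then show False using eq[of k] triangle[of x "e k" y] xy eM[of k] commute[of "e k" y] by simp
    qed
  qed
  have m\<iota>: "\<iota> \<in> borel_measurable X"
    unfolding \<iota>_def
  proof (intro measurable_pack measurable_coordinatewise_then_product)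
    fix k m
    have [measurable]: "(\<lambda>x. d x (e k)) \<in> borel_measurable X"
      unfolding borel_measurable_iff_less
    proof
      fix a
      have "{w \<in> space X. d w (e k) < a} = mball (e k) a" unfolding M using eM by (auto simp: commute)
      then show "{w \<in> space X. d w (e k) < a} \<in> sets X" using openX by simp
    qed
    show "(\<lambda>x. nat \<lfloor>2 ^ m * d x (e k)\<rfloor>) \<in> borel_measurable X" 
      by (rule borel_measurable_into_nat) measurable
  qed
  have "\<iota> ` S \<in> sets borel" if "S \<in> sets X" for S
  proof -
    have "S \<in> sigma_sets M {U. openin mtopology U}" using that T(4) Md(3) by simp
    then show ?thesis
    proof induction
      case (Basic U)
      then have U: "openin mtopology U" by simp
      \<comment> \<open>An open set is the union of the balls with centre \<open>e k\<close> and radius \<open>1 / (m + 1)\<close> in it.\<close>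
      define J where "J = {(k, m). mball (e k) (1 / real (Suc m)) \<subseteq> U}"
      have "U = (\<Union>(k, m)\<in>J. mball (e k) (1 / real (Suc m)))"
      proof (intro equalityI subsetI)
        fix x assume "x \<in> U"
        then obtain r where r: "r > 0" "mball x r \<subseteq> U" using U by (auto simp: openin_mtopology)
        have xM: "x \<in> M" using \<open>x \<in> U\<close> U by (auto simp: openin_mtopology)
        obtain m where m: "1 / real (Suc m) < r / 2" using nat_approx_posE[of "r / 2"] r(1) by auto
        obtain k where k: "d x (e k) < 1 / real (Suc m)" using dense[OF xM, of "1 / real (Suc m)"] by auto
        have "mball (e k) (1 / real (Suc m)) \<subseteq> mball x r"
        proof
          fix y assume y: "y \<in> mball (e k) (1 / real (Suc m))"
          then show "y \<in> mball x r" using triangle[of x "e k" y] xM k m by auto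
        qed
        then have "(k, m) \<in> J" using r(2) by (auto simp: J_def)
        moreover have "x \<in> mball (e k) (1 / real (Suc m))" using k xM eM by (simp add: commute)
        ultimately show "x \<in> (\<Union>(k, m)\<in>J. mball (e k) (1 / real (Suc m)))" by blast
      qed (auto simp: J_def)
      then have "\<iota> ` U = \<iota> ` (\<Union>(k, m)\<in>J. mball (e k) (1 / real (Suc m)))" by simp
      also have "\<dots> = (\<Union>(k, m)\<in>J. \<iota> ` mball (e k) (1 / real (Suc m)))" by blast
      also have "\<dots> = (\<Union>(k, m)\<in>J. K \<inter> {p \<in> space borel. \<rho> k p < 1 / real (Suc m)})"
      proof -
        have "\<iota> ` mball (e k) r = K \<inter> {p \<in> space borel. \<rho> k p < r}" for k r
          unfolding \<iota>M[symmetric] using \<rho>\<iota> eM by (auto simp: commute image_iff)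
        then show ?thesis by simp
      qed
      also have "\<dots> \<in> sets borel"
      proof -
        have [measurable]: "K \<in> sets borel" by (rule Km)
        have "K \<inter> {p \<in> space borel. \<rho> k p < r} \<in> sets borel" for k r by measurable
        then show ?thesis by (intro sets.countable_UN'') auto
      qed
      finally show ?case .
    next
      case Empty
      then show ?case by simp
    next
      case (Compl S)
      have "S \<subseteq> M" using sigma_sets_into_sp[OF _ Compl(1)] by (auto simp: openin_mtopology)
      then have "\<iota> ` (M - S) = K - \<iota> ` S" using inj_on_image_set_diff[OF inj, of M S] \<iota>M by simp
      then show ?case using Km Compl(2) by simp
    next
      case (Union S)
      then show ?case by (simp add: image_UN)
    qed
  qed
  then show ?thesis using m\<iota> inj M by blast
qed

section \<open>Topologies that make Borel maps continuous\<close>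

lemma resolve_family:
  assumes B: "\<And>i :: nat. B i \<in> sets (borel :: (nat \<Rightarrow> nat) measure)"
  shows "\<exists>y :: (nat \<Rightarrow> nat) \<Rightarrow> nat \<Rightarrow> nat. y \<in> borel_measurable borel \<and> closed {(x, w). w = y x} \<and>
           (\<forall>i x. x \<in> B i \<longleftrightarrow> y x (prod_encode (i, 0)) \<noteq> 0)"
proof -
  have "\<exists>z. \<forall>i. resolves (z i) (B i)" using borel_resolvable[OF B] by (intro choice allI)
  then obtain z where "\<forall>i. resolves (z i) (B i)" ..
  then have z: "z i \<in> borel_measurable borel" "closed {(x, w). w = z i x}"
    "\<And>x. x \<in> B i \<longleftrightarrow> z i x 0 \<noteq> 0" for i by (simp_all add: resolves_def)
  define y where "y x = pack (\<lambda>i. z i x)" for x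
  have 1: "y \<in> borel_measurable borel" unfolding y_def by (rule measurable_pack) (rule z(1))
  have "{(x, w). w = y x} = (\<Inter>i. {(x, w). slice i w = z i x})"
    by (auto simp: y_def intro: pack_eqI)
  then have 2: "closed {(x, w). w = y x}"
    by (simp only:) (intro closed_INT ballI closed_graph_slice z(2))
  have 3: "x \<in> B i \<longleftrightarrow> y x (prod_encode (i, 0)) \<noteq> 0" for i x
    using z(3)[of x i] by (simp add: y_def pack_def)
  show ?thesis by (intro exI[of _ y] conjI allI 1 2 3)
qed

lemma continuous_on_into_nat:
  fixes f :: "'a :: topological_space \<Rightarrow> nat"
  assumes "\<And>v. open (W v)" "\<And>p v. p \<in> S \<Longrightarrow> f p = v \<longleftrightarrow> p \<in> W v"
  shows "continuous_on S f"
  unfolding continuous_openin_preimage_eq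
proof (intro allI impI)
  fix t :: "nat set"
  have "S \<inter> f -` t = S \<inter> (\<Union>v\<in>t. W v)" using assms(2) by auto
  then show "openin (top_of_set S) (S \<inter> f -` t)" using assms(1) by (simp add: openin_open_Int open_UN)
qed

text \<open>Resolving the preimages of basic sets makes all \<open>g k\<close> continuous into the old topology, but the
  resolution has itself created new open sets.  So the step is iterated: \<open>Y (l + 1)\<close> resolves the
  preimages under each \<open>g k\<close> of the sets that are open through \<open>Y l\<close>, and \<open>c\<close> collects all \<open>Y l\<close>.
  The image stays closed because every \<open>Y l\<close> has a closed graph and \<open>Y 0\<close> is the identity.\<close>
theorem borel_maps_continuous:
  fixes D :: "nat \<Rightarrow> (nat \<Rightarrow> nat) set"
  assumes K[measurable]: "K \<in> sets borel" and D[measurable]: "\<And>k. D k \<in> sets borel"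
    and g[measurable]: "\<And>k. g k \<in> borel_measurable borel" and DK: "\<And>k. D k \<subseteq> K"
  shows "\<exists>c. c \<in> borel_measurable borel \<and> (\<forall>x. slice 0 (c x) = x) \<and> closed (c ` K) \<and>
           (\<forall>k. openin (top_of_set (c ` K)) (c ` D k) \<and>
                continuous_on (c ` D k) (\<lambda>p. c (g k (slice 0 p))))"
proof -
  \<comment> \<open>The sets to be resolved after \<open>y\<close>, indexed by a tag \<open>a\<close> and an argument \<open>b\<close>; tags from 2 on
      stand for the maps \<open>g (a - 2)\<close>.\<close>
  define fam where "fam y i = (case prod_decode i of (a, b) \<Rightarrow>
      if a = 0 then K else if a = 1 then D b
      else case prod_decode b of (n, v) \<Rightarrow> {x. y (g (a - 2) x) n = v})"
    for y :: "(nat \<Rightarrow> nat) \<Rightarrow> nat \<Rightarrow> nat" and i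
  have "\<forall>B. \<exists>y :: (nat \<Rightarrow> nat) \<Rightarrow> nat \<Rightarrow> nat. (\<forall>i. B i \<in> sets (borel :: (nat \<Rightarrow> nat) measure)) \<longrightarrow>
      y \<in> borel_measurable borel \<and> closed {(x, w). w = y x} \<and>
      (\<forall>i x. x \<in> B i \<longleftrightarrow> y x (prod_encode (i, 0)) \<noteq> 0)"
    using resolve_family by blast
  then have "\<exists>R :: (nat \<Rightarrow> (nat \<Rightarrow> nat) set) \<Rightarrow> (nat \<Rightarrow> nat) \<Rightarrow> nat \<Rightarrow> nat. \<forall>B. (\<forall>i. B i \<in> sets (borel :: (nat \<Rightarrow> nat) measure)) \<longrightarrow>
      R B \<in> borel_measurable borel \<and> closed {(x, w). w = R B x} \<and>
      (\<forall>i x. x \<in> B i \<longleftrightarrow> R B x (prod_encode (i, 0)) \<noteq> 0)"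
    by (rule choice)
  then obtain R :: "(nat \<Rightarrow> (nat \<Rightarrow> nat) set) \<Rightarrow> (nat \<Rightarrow> nat) \<Rightarrow> nat \<Rightarrow> nat"
    where R: "\<forall>B. (\<forall>i. B i \<in> sets (borel :: (nat \<Rightarrow> nat) measure)) \<longrightarrow>
      R B \<in> borel_measurable borel \<and> closed {(x, w). w = R B x} \<and>
      (\<forall>i x. x \<in> B i \<longleftrightarrow> R B x (prod_encode (i, 0)) \<noteq> 0)" ..
  note RB = R[THEN spec, THEN mp]
  have fam: "fam y i \<in> sets borel" if [measurable]: "y \<in> borel_measurable borel" for y i
  proof -
    have "{x \<in> space borel. y (g a x) n = v} \<in> sets borel" for a n v by measurable
    then show ?thesis by (simp add: fam_def split: prod.split)
  qed
  define Y where "Y = rec_nat (\<lambda>x. x) (\<lambda>_ y. R (fam y))"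
  have Y0: "Y 0 = (\<lambda>x. x)" and YS: "Y (Suc l) = R (fam (Y l))" for l by (simp_all add: Y_def)
  have Ym[measurable]: "Y l \<in> borel_measurable borel" for l
  proof (induction l)
    case (Suc l)
    then show ?case using RB[OF allI, OF fam[OF Suc], THEN conjunct1] by (simp add: YS)
  qed (simp add: Y0)
  have Yc: "closed {(x, w). w = Y l x}" for l
  proof (cases l)
    case 0
    then show ?thesis using closed_graph_continuous[OF continuous_on_id] by (simp add: Y0)
  next
    case (Suc m)
    then show ?thesis using RB[OF allI, OF fam[OF Ym[of m]], THEN conjunct2, THEN conjunct1] by (simp add: YS)
  qed
  have Yr: "x \<in> fam (Y l) i \<longleftrightarrow> Y (Suc l) x (prod_encode (i, 0)) \<noteq> 0" for l i x
    unfolding YS by (rule RB[OF allI, THEN conjunct2, THEN conjunct2, THEN spec, THEN spec]) (rule fam[OF Ym])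
  define c where "c x = pack (\<lambda>l. Y l x)" for x
  have cs: "slice l (c x) = Y l x" for l x by (simp add: c_def)
  have c0: "slice 0 (c x) = x" for x by (simp add: cs Y0)
  have cm: "c \<in> borel_measurable borel" unfolding c_def by (rule measurable_pack) (rule Ym)
  define q where "q i l = prod_encode (Suc l, prod_encode (i, 0))" for i l
  have q: "c x (q i l) \<noteq> 0 \<longleftrightarrow> x \<in> fam (Y l) i" for x i l
    unfolding Yr by (simp add: c_def pack_def q_def)
  have famK: "fam y (prod_encode (0, 0)) = K" and famD: "fam y (prod_encode (1, k)) = D k"
    and famg: "fam y (prod_encode (k + 2, prod_encode (n, v))) = {x. y (g k x) n = v}" for y k n v
    by (simp_all add: fam_def)
  have rc: "c ` K = (\<Inter>l. (\<lambda>p. (slice 0 p, slice l p)) -` {(x, w). w = Y l x}) \<inter>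
      {p. p (q (prod_encode (0, 0)) 0) \<noteq> 0}" (is "?L = ?R")
  proof (intro set_eqI iffI)
    fix p assume "p \<in> ?L"
    then show "p \<in> ?R" using q[of _ "prod_encode (0, 0)" 0] by (auto simp: cs Y0 famK)
  next
    fix p assume p: "p \<in> ?R"
    then have "slice l p = Y l (slice 0 p)" for l by blast
    then have pc: "c (slice 0 p) = p" unfolding c_def by (intro pack_eqI[symmetric])
    have "p (q (prod_encode (0, 0)) 0) \<noteq> 0" using p by blast
    then have "slice 0 p \<in> K"
      using q[of "slice 0 p" "prod_encode (0, 0)" 0] unfolding pc famK by blast
    then show "p \<in> ?L" using pc by (metis imageI)
  qed
  have "closed ?R"
  proof (intro closed_Int closed_INT ballI)
    show "closed {p :: nat \<Rightarrow> nat. p (q (prod_encode (0, 0)) 0) \<noteq> 0}"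
      by (rule closed_coord2[of "\<lambda>a _. a \<noteq> 0"])
    show "closed ((\<lambda>p. (slice 0 p, slice l p)) -` {(x, w). w = Y l x})" for l
      by (rule closed_vimage[OF Yc]) (intro continuous_on_Pair continuous_on_slice continuous_on_id)
  qed
  then have cl: "closed (c ` K)" by (simp only: rc)
  have op: "openin (top_of_set (c ` K)) (c ` D k)" for k
  proof -
    have "c ` D k = c ` K \<inter> {p. p (q (prod_encode (1, k)) 0) \<noteq> 0}"
    proof (intro set_eqI iffI)
      fix p assume "p \<in> c ` D k"
      then show "p \<in> c ` K \<inter> {p. p (q (prod_encode (1, k)) 0) \<noteq> 0}"
        using DK[of k] q[of _ "prod_encode (1, k)" 0] unfolding famD by blast
    next
      fix p assume "p \<in> c ` K \<inter> {p. p (q (prod_encode (1, k)) 0) \<noteq> 0}"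
      then obtain x where "p = c x" "c x (q (prod_encode (1, k)) 0) \<noteq> 0" by auto
      then show "p \<in> c ` D k" unfolding q famD by blast
    qed
    then show ?thesis using open_coord_pred[of "\<lambda>a. a \<noteq> 0"] by (simp add: openin_open_Int)
  qed
  have ct: "continuous_on (c ` D k) (\<lambda>p. c (g k (slice 0 p)))" for k
  proof (rule continuous_on_coordinatewise_then_product)
    fix m
    obtain l n where m: "m = prod_encode (l, n)" by (metis prod_decode_inverse surj_pair)
    show "continuous_on (c ` D k) (\<lambda>p. c (g k (slice 0 p)) m)"
    proof (rule continuous_on_into_nat)
      fix v
      show "open {p :: nat \<Rightarrow> nat. p (q (prod_encode (k + 2, prod_encode (n, v))) l) \<noteq> 0}"
        by (rule open_coord_pred)
      fix p assume "p \<in> c ` D k"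
      then obtain x where x: "p = c x" by blast
      have "c (g k x) m = Y l (g k x) n" by (simp add: c_def pack_def m)
      then show "c (g k (slice 0 p)) m = v \<longleftrightarrow>
          p \<in> {p. p (q (prod_encode (k + 2, prod_encode (n, v))) l) \<noteq> 0}"
        unfolding mem_Collect_eq x q famg c0 by simp
    qed
  qed
  show ?thesis by (intro exI[of _ c] conjI allI cm c0 cl op ct)
qed

section \<open>The Hechler topology\<close>

text \<open>Basic neighbourhoods of the Hechler topology: a prefix of length \<open>m\<close> is fixed and a lower bound
  is imposed on all later values.  One sequence \<open>u\<close> provides both, which makes \<open>u\<close> a member.\<close>
definition hnbhd :: "(nat \<Rightarrow> nat) \<Rightarrow> nat \<Rightarrow> (nat \<Rightarrow> nat) set" where
  "hnbhd u m = {x. (\<forall>i<m. x i = u i) \<and> (\<forall>i\<ge>m. u i \<le> x i)}"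

lemma hnbhd_self [simp]: "u \<in> hnbhd u m"
  by (simp add: hnbhd_def)

lemma hnbhd_mono: "v \<in> hnbhd u m \<Longrightarrow> m \<le> k \<Longrightarrow> hnbhd v k \<subseteq> hnbhd u m"
  unfolding hnbhd_def by (auto, metis le_less_trans not_less order_trans)

text \<open>As neighbourhoods of points of \<open>hnbhd u m\<close> lie in \<open>hnbhd u m\<close> once they fix at least \<open>m\<close> values, these
  are the open, nowhere dense and meager sets of a topology that refines the product topology.\<close>
definition hopen :: "(nat \<Rightarrow> nat) set \<Rightarrow> bool" where
  "hopen U \<longleftrightarrow> (\<forall>x\<in>U. \<exists>m. hnbhd x m \<subseteq> U)"

definition hnowhere_dense :: "(nat \<Rightarrow> nat) set \<Rightarrow> bool" where
  "hnowhere_dense S \<longleftrightarrow> (\<forall>u m. \<exists>v k. m \<le> k \<and> v \<in> hnbhd u m \<and> hnbhd v k \<inter> S = {})"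

definition hmeager :: "(nat \<Rightarrow> nat) set \<Rightarrow> bool" where
  "hmeager M \<longleftrightarrow> (\<exists>S. (\<forall>n::nat. hnowhere_dense (S n)) \<and> M \<subseteq> (\<Union>n. S n))"

lemma hmeager_subset: "hmeager M \<Longrightarrow> N \<subseteq> M \<Longrightarrow> hmeager N"
  unfolding hmeager_def by blast

lemma hmeager_UN:
  assumes "\<And>n::nat. hmeager (M n)" shows "hmeager (\<Union>n. M n)"
proof -
  have "\<exists>S. \<forall>n. (\<forall>k::nat. hnowhere_dense (S n k)) \<and> M n \<subseteq> (\<Union>k. S n k)"
    using assms unfolding hmeager_def by (intro choice) blast
  then obtain S where S: "\<And>n k::nat. hnowhere_dense (S n k)" "\<And>n. M n \<subseteq> (\<Union>k. S n k)" by blast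
  have "(\<Union>n. M n) \<subseteq> (\<Union>j. S (fst (prod_decode j)) (snd (prod_decode j)))"
  proof
    fix x assume "x \<in> (\<Union>n. M n)"
    then obtain n k where "x \<in> S n k" using S(2) by blast
    then have "x \<in> S (fst (prod_decode (prod_encode (n, k)))) (snd (prod_decode (prod_encode (n, k))))" by simp
    then show "x \<in> (\<Union>j. S (fst (prod_decode j)) (snd (prod_decode j)))" by blast
  qed
  then show ?thesis unfolding hmeager_def
    by (intro exI[of _ "\<lambda>j. S (fst (prod_decode j)) (snd (prod_decode j))"]) (simp add: S(1))
qed

lemma hnowhere_dense_imp_hmeager: "hnowhere_dense S \<Longrightarrow> hmeager S"
  unfolding hmeager_def by (intro exI[of _ "\<lambda>_. S"]) auto

lemma hmeager_empty: "hmeager {}"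
  by (rule hnowhere_dense_imp_hmeager) (auto simp: hnowhere_dense_def intro: hnbhd_self)
text \<open>The Baire category theorem for this topology: shrink neighbourhoods successively, avoiding one
  nowhere dense set and fixing one more value each time; the fixed values form the required point.\<close>
theorem hechler_baire:
  assumes "hmeager M" shows "\<exists>x \<in> hnbhd u m. x \<notin> M"
proof -
  obtain S where S: "\<And>n::nat. hnowhere_dense (S n)" "M \<subseteq> (\<Union>n. S n)"
    using assms unfolding hmeager_def by blast
  have "\<exists>f. \<forall>n. (n \<le> snd (f n) \<and> (n = 0 \<longrightarrow> f n = (u, m))) \<and>
     (snd (f n) \<le> snd (f (Suc n)) \<and> fst (f (Suc n)) \<in> hnbhd (fst (f n)) (snd (f n)) \<and>
      hnbhd (fst (f (Suc n))) (snd (f (Suc n))) \<inter> S n = {})"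
  proof (rule dependent_nat_choice)
    fix p n assume "n \<le> snd p \<and> (n = 0 \<longrightarrow> p = (u, m))"
    obtain v k where vk: "snd p \<le> k" "v \<in> hnbhd (fst p) (snd p)" "hnbhd v k \<inter> S n = {}"
      using S(1)[of n] unfolding hnowhere_dense_def by blast
    have "hnbhd v (Suc (n + k)) \<subseteq> hnbhd v k" by (rule hnbhd_mono) auto
    then show "\<exists>q. (Suc n \<le> snd q \<and> (Suc n = 0 \<longrightarrow> q = (u, m))) \<and> snd p \<le> snd q \<and>
      fst q \<in> hnbhd (fst p) (snd p) \<and> hnbhd (fst q) (snd q) \<inter> S n = {}"
      using vk by (intro exI[of _ "(v, Suc (n + k))"]) auto
  qed auto
  then obtain f where f: "\<And>n. n \<le> snd (f n)" "f 0 = (u, m)"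
    "\<And>n. snd (f n) \<le> snd (f (Suc n))" "\<And>n. fst (f (Suc n)) \<in> hnbhd (fst (f n)) (snd (f n))"
    "\<And>n. hnbhd (fst (f (Suc n))) (snd (f (Suc n))) \<inter> S n = {}" by metis
  define N where "N n = hnbhd (fst (f n)) (snd (f n))" for n
  have NS: "N (Suc n) \<subseteq> N n" for n
    unfolding N_def by (rule hnbhd_mono) (use f in auto)
  have dec: "N k \<subseteq> N n" if "n \<le> k" for n k
    using that by (induction k rule: dec_induct) (use NS in auto)
  define x where "x i = fst (f (Suc i)) i" for i
  have xi: "x i = fst (f k) i" if "i < k" for i k
  proof -
    have "fst (f k) \<in> N (Suc i)" using dec[of "Suc i" k] that by (auto simp: N_def)
    moreover have "i < snd (f (Suc i))" using f(1)[of "Suc i"] by simp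
    ultimately show ?thesis by (auto simp: N_def hnbhd_def x_def)
  qed
  have xN: "x \<in> N n" for n
  proof -
    have "fst (f (Suc i + n)) \<in> N n" for i using dec[of n "Suc i + n"] by (auto simp: N_def)
    moreover have "x i = fst (f (Suc i + n)) i" for i by (rule xi) simp
    ultimately show ?thesis by (auto simp: N_def hnbhd_def) 
  qed
  have "x \<notin> S n" for n using xN[of "Suc n"] f(5)[of n] by (auto simp: N_def)
  then have "x \<notin> M" using S(2) by blast
  moreover have "x \<in> hnbhd u m" using xN[of 0] f(2) by (simp add: N_def)
  ultimately show ?thesis by blast
qed

text \<open>Induction over the Borel sets.  For a complement, the interior \<open>V\<close> of the complement of \<open>U\<close> is
  taken; the boundary of \<open>U\<close> is nowhere dense.\<close>
theorem hechler_baire_property: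
  assumes "B \<in> sets (borel :: (nat \<Rightarrow> nat) measure)"
  shows "\<exists>U. hopen U \<and> hmeager ((B - U) \<union> (U - B))"
proof -
  from borel_seq_sigma_sets[OF assms] show ?thesis
  proof induction
    case (Basic B)
    then obtain i A where B: "B = {f. f i \<in> A}" by auto
    have "hnbhd x (Suc i) \<subseteq> B" if "x \<in> B" for x
      using that by (auto simp: hnbhd_def B)
    then have "hopen B" unfolding hopen_def by blast
    moreover have "hmeager {}" by (rule hmeager_empty)
    ultimately show ?case by (intro exI[of _ B]) simp
  next
    case Empty
    have "hmeager {}" by (rule hmeager_empty)
    then show ?case by (intro exI[of _ "{}"]) (simp add: hopen_def)
  next
    case (Compl B)
    then obtain U where U: "hopen U" "hmeager ((B - U) \<union> (U - B))" by blast
    define V where "V = {x. \<exists>m. hnbhd x m \<inter> U = {}}"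
    have sub: "hnbhd x m \<subseteq> V" if "hnbhd x m \<inter> U = {}" for x m
      using that hnbhd_mono[of _ x m m] unfolding V_def by blast
    have "hopen V" unfolding hopen_def
    proof
      fix x assume "x \<in> V"
      then obtain m where "hnbhd x m \<inter> U = {}" by (auto simp: V_def)
      then show "\<exists>m. hnbhd x m \<subseteq> V" using sub by blast
    qed
    have "hnowhere_dense (- U - V)" unfolding hnowhere_dense_def
    proof (intro allI)
      fix u m
      show "\<exists>v k. m \<le> k \<and> v \<in> hnbhd u m \<and> hnbhd v k \<inter> (- U - V) = {}"
      proof (cases "hnbhd u m \<inter> U = {}")
        case True
        then show ?thesis using sub[of u m] hnbhd_self by blast
      next
        case False
        then obtain x where x: "x \<in> hnbhd u m" "x \<in> U" by blast
        then obtain k where k: "hnbhd x k \<subseteq> U" using U(1) by (auto simp: hopen_def)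
        have "hnbhd x (m + k) \<subseteq> hnbhd x k" by (rule hnbhd_mono) auto
        then have "hnbhd x (m + k) \<inter> (- U - V) = {}" using k by blast
        then show ?thesis using x(1) le_add1 by blast
      qed
    qed
    then have "hmeager (\<Union>n::nat. if n = 0 then - U - V else (B - U) \<union> (U - B))"
      using U(2) hnowhere_dense_imp_hmeager by (intro hmeager_UN) simp
    then have "hmeager ((UNIV - B - V) \<union> (V - (UNIV - B)))"
    proof (rule hmeager_subset)
      have "U \<inter> V = {}" using hnbhd_self unfolding V_def by blast
      then have "(UNIV - B - V) \<union> (V - (UNIV - B)) \<subseteq> (- U - V) \<union> ((B - U) \<union> (U - B))" by blast
      also have "\<dots> \<subseteq> (\<Union>n::nat. if n = 0 then - U - V else (B - U) \<union> (U - B))" by (auto intro: exI[of _ 0])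
      finally show "(UNIV - B - V) \<union> (V - (UNIV - B)) \<subseteq> \<dots>" .
    qed
    then show ?case using \<open>hopen V\<close> by blast
  next
    case (Union B)
    then have "\<exists>U. \<forall>n. hopen (U n) \<and> hmeager ((B n - U n) \<union> (U n - B n))" by (intro choice) blast
    then obtain U where U: "\<And>n. hopen (U n)" "\<And>n. hmeager ((B n - U n) \<union> (U n - B n))" by blast
    have "hopen (\<Union>n. U n)" unfolding hopen_def
    proof
      fix x assume "x \<in> (\<Union>n. U n)"
      then obtain n where "x \<in> U n" by blast
      then obtain m where "hnbhd x m \<subseteq> U n" using U(1)[of n] unfolding hopen_def by blast
      then show "\<exists>m. hnbhd x m \<subseteq> (\<Union>n. U n)" by blast
    qed
    moreover have "hmeager (((\<Union>n. B n) - (\<Union>n. U n)) \<union> ((\<Union>n. U n) - (\<Union>n. B n)))"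
      by (rule hmeager_subset[OF hmeager_UN[of "\<lambda>n. (B n - U n) \<union> (U n - B n)", OF U(2)]]) blast
    ultimately show ?case by blast
  qed
qed

definition graft :: "nat \<Rightarrow> (nat \<Rightarrow> nat) \<Rightarrow> (nat \<Rightarrow> nat) \<Rightarrow> nat \<Rightarrow> nat" where
  "graft m u x = (\<lambda>i. if i < m then u i else x i)"

text \<open>Changing finitely many values is a homeomorphism between open sets, so it preserves smallness.\<close>
lemma hnowhere_dense_graft:
  assumes "hnowhere_dense S"
  shows "hnowhere_dense {x. graft m u x \<in> S}"
  unfolding hnowhere_dense_def
proof (intro allI)
  fix v l
  obtain w k where wk: "m + l \<le> k" "w \<in> hnbhd (graft m u v) (m + l)" "hnbhd w k \<inter> S = {}"
    using assms unfolding hnowhere_dense_def by blast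
  define w' where "w' = graft m v w"
  have "w' i = v i" if "i < l" for i
    using wk(2) that by (auto simp: hnbhd_def w'_def graft_def)
  moreover have "v i \<le> w' i" for i
  proof (cases "i < m + l")
    case True
    then show ?thesis using wk(2) by (auto simp: hnbhd_def w'_def graft_def)
  next
    case False
    then have "graft m u v i \<le> w i" using wk(2) by (auto simp: hnbhd_def)
    then show ?thesis using False by (auto simp: w'_def graft_def)
  qed
  ultimately have "w' \<in> hnbhd v l" by (simp add: hnbhd_def)
  moreover have "hnbhd w' k \<inter> {x. graft m u x \<in> S} = {}"
  proof -
    have "graft m u x \<in> hnbhd w k" if x: "x \<in> hnbhd w' k" for x
    proof -
      have "graft m u x i = w i" if "i < k" for i
        using x that wk(2) by (cases "i < m") (auto simp: hnbhd_def w'_def graft_def)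
      moreover have "w i \<le> graft m u x i" if "\<not> i < k" for i
        using x that wk(1) by (auto simp: hnbhd_def w'_def graft_def)
      ultimately show ?thesis by (simp add: hnbhd_def)
    qed
    then show ?thesis using wk(3) by blast
  qed
  ultimately show "\<exists>w k. l \<le> k \<and> w \<in> hnbhd v l \<and> hnbhd w k \<inter> {x. graft m u x \<in> S} = {}"
    using wk(1) by (meson add_leD2)
qed

lemma hmeager_graft:
  assumes "hmeager M" shows "hmeager {x. graft m u x \<in> M}"
proof -
  obtain S where S: "\<And>n::nat. hnowhere_dense (S n)" "M \<subseteq> (\<Union>n. S n)"
    using assms unfolding hmeager_def by blast
  show ?thesis unfolding hmeager_def
    by (intro exI[of _ "\<lambda>n. {x. graft m u x \<in> S n}"]) (use S hnowhere_dense_graft in auto)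
qed

text \<open>For each \<open>n\<close> some \<open>P n r\<close> is comeager in a neighbourhood \<open>hnbhd (u n) (m n)\<close>.  A sequence above all
  the bounds of these neighbourhoods enters each of them after changing a prefix, and in the Hechler topology
  such sequences form a nonmeager set, so a generic one can be chosen.  Since \<open>m n\<close> may be increased to be at
  least \<open>n\<close>, only finitely many bounds act on each value, and a single sequence can dominate them.\<close>
theorem hechler_domination:
  fixes P :: "nat \<Rightarrow> nat \<Rightarrow> (nat \<Rightarrow> nat) set"
  assumes P: "\<And>n r. P n r \<in> sets borel" and cover: "\<And>n. (\<Union>r. P n r) = UNIV"
  shows "\<exists>x. \<forall>n. \<exists>r m u. graft m u x \<in> P n r \<and> r \<le> x n \<and> m \<le> x n \<and> (\<forall>i<m. u i \<le> x n)"
proof -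
  have "\<exists>r u m. hmeager (hnbhd u m - P n r)" for n
  proof -
    have "\<exists>U. \<forall>r. hopen (U r) \<and> hmeager ((P n r - U r) \<union> (U r - P n r))"
      using hechler_baire_property[OF P] by (intro choice allI)
    then obtain U where U: "\<And>r. hopen (U r)" "\<And>r. hmeager ((P n r - U r) \<union> (U r - P n r))" by blast
    have "\<exists>r. U r \<noteq> {}"
    proof (rule ccontr)
      assume "\<not> ?thesis"
      then have "hmeager (P n r)" for r using U(2)[of r] by simp
      then have "hmeager (\<Union>r. P n r)" by (rule hmeager_UN)
      then show False using hechler_baire cover by blast
    qed
    then obtain r u where u: "u \<in> U r" by blast
    then obtain m where "hnbhd u m \<subseteq> U r" using U(1)[of r] unfolding hopen_def by blast
    then have "hmeager (hnbhd u m - P n r)" by (intro hmeager_subset[OF U(2)[of r]]) blast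
    then show ?thesis by blast
  qed
  then have "\<forall>n. \<exists>r u m. hmeager (hnbhd u m - P n r)" by blast
  then have "\<exists>r u m. \<forall>n. hmeager (hnbhd (u n) (m n) - P n (r n))" by (simp only: choice_iff)
  then obtain r u m0 where m0: "\<And>n. hmeager (hnbhd (u n) (m0 n) - P n (r n))" by blast
  define m where "m n = m0 n + n" for n
  have meag: "hmeager (hnbhd (u n) (m n) - P n (r n))" for n
    by (rule hmeager_subset[OF m0]) (use hnbhd_mono[of "u n" "u n" "m0 n" "m n"] in \<open>auto simp: m_def\<close>)
  \<comment> \<open>The bound \<open>u n\<close> matters only from \<open>m n \<ge> n\<close> on, so at \<open>i\<close> only those with \<open>n \<le> i\<close> have to be
      dominated.\<close>
  define h where "h i = r i + m i + (\<Sum>k<m i. u i k) + (\<Sum>n\<le>i. u n i)" for i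
  have "hmeager (\<Union>n. {x. graft (m n) (u n) x \<in> hnbhd (u n) (m n) - P n (r n)})"
    by (intro hmeager_UN hmeager_graft meag)
  then obtain x where "x \<in> hnbhd h 0"
    and "x \<notin> (\<Union>n. {x. graft (m n) (u n) x \<in> hnbhd (u n) (m n) - P n (r n)})"
    using hechler_baire[of _ h 0] by blast
  then have x: "x \<in> hnbhd h 0" "\<And>n. graft (m n) (u n) x \<notin> hnbhd (u n) (m n) - P n (r n)"
    by simp_all
  have hx: "h i \<le> x i" for i using x(1) by (simp add: hnbhd_def)
  have "graft (m n) (u n) x \<in> P n (r n) \<and> r n \<le> x n \<and> m n \<le> x n \<and> (\<forall>i<m n. u n i \<le> x n)" for n
  proof (intro conjI allI impI)
    have "u n i \<le> x i" if "m n \<le> i" for i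
    proof -
      have "u n i \<le> (\<Sum>n\<le>i. u n i)" by (rule member_le_sum) (use that in \<open>auto simp: m_def\<close>)
      also have "\<dots> \<le> h i" by (simp add: h_def)
      finally show ?thesis using hx[of i] by simp
    qed
    then have "graft (m n) (u n) x \<in> hnbhd (u n) (m n)" by (auto simp: hnbhd_def graft_def)
    then show "graft (m n) (u n) x \<in> P n (r n)" using x(2) by blast
    show "r n \<le> x n" "m n \<le> x n" using hx[of n] by (auto simp: h_def)
    fix i assume "i < m n"
    then have "u n i \<le> (\<Sum>k<m n. u n k)" by (intro member_le_sum) auto
    also have "\<dots> \<le> h n" by (simp add: h_def)
    finally show "u n i \<le> x n" using hx[of n] by simp
  qed
  then show ?thesis by blast
qed

section \<open>Graphs generated by continuous injections\<close>

text \<open>The normal form to which a locally finite Borel graph is brought: the edges are covered by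
  countably many injective continuous maps with relatively open domains in a closed set \<open>F\<close>.\<close>
locale generated_graph =
  fixes F :: "(nat \<Rightarrow> nat) set" and D :: "nat \<Rightarrow> (nat \<Rightarrow> nat) set"
    and g g' :: "nat \<Rightarrow> (nat \<Rightarrow> nat) \<Rightarrow> nat \<Rightarrow> nat" and H :: "((nat \<Rightarrow> nat) \<times> (nat \<Rightarrow> nat)) set"
  assumes closed_F: "closed F"
    and open_D: "openin (top_of_set F) (D k)"
    and continuous_g: "continuous_on (D k) (g k)"
    and g_in_F: "a \<in> D k \<Longrightarrow> g k a \<in> F"
    and measurable_g: "g k \<in> borel_measurable borel"
    and measurable_g': "g' k \<in> borel_measurable borel"
    and g'_g: "a \<in> D k \<Longrightarrow> g' k (g k a) = a"
    and H_eq: "H = (\<Union>k. {(a, g k a) |a. a \<in> D k})"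
    and sym_H: "sym H"

text \<open>Code the points by sequences, cover the edges by partial injections, and change the topology so
  that these become continuous.  Only the first and the last step move the points, and both are
  Borel isomorphisms onto their images.\<close>
theorem graph_realization:
  assumes X: "standard_borel_space X" and ne: "space X \<noteq> {}"
    and G: "borel_graph X G" and lf: "locally_finite_graph X G"
  shows "\<exists>j F D g g' H. generated_graph F D g g' H \<and> j \<in> borel_measurable X \<and>
           inj_on j (space X) \<and> j ` space X = F \<and> (\<forall>S\<in>sets X. j ` S \<in> sets borel) \<and>
           H = {(j x, j y) |x y. (x, y) \<in> G}"
proof -
  obtain \<iota> :: "'a \<Rightarrow> nat \<Rightarrow> nat" where \<iota>: "\<iota> \<in> borel_measurable X" "inj_on \<iota> (space X)"
    "\<forall>S\<in>sets X. \<iota> ` S \<in> sets borel"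
    using standard_borel_embedding[OF X ne] by (elim exE conjE)
  have GX: "G \<in> sets (X \<Otimes>\<^sub>M X)" and symG: "sym G" using G by (simp_all add: borel_graph_def)
  have Gsub: "x \<in> space X" "y \<in> space X" if "(x, y) \<in> G" for x y
    using sets.sets_into_space[OF GX] that by (auto simp: space_pair_measure)
  obtain x0 where x0: "x0 \<in> space X" using ne by blast
  define K where "K = \<iota> ` space X"
  have [measurable]: "K \<in> sets borel" using \<iota>(3) by (simp add: K_def)
  \<comment> \<open>A total Borel left inverse of \<open>\<iota>\<close>; outside the image it has the arbitrary value \<open>x0\<close>.\<close>
  define \<kappa> where "\<kappa> p = (if p \<in> K then inv_into (space X) \<iota> p else x0)" for p
  have \<kappa>\<iota>: "\<kappa> (\<iota> x) = x" if "x \<in> space X" for x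
    using that \<iota>(2) by (simp add: \<kappa>_def K_def)
  have [measurable]: "\<kappa> \<in> measurable borel X"
  proof (rule measurableI)
    fix p show "\<kappa> p \<in> space X" using x0 inv_into_into[of p \<iota> "space X"] by (simp add: \<kappa>_def K_def)
  next
    fix S assume S: "S \<in> sets X"
    have "\<kappa> -` S \<inter> space borel = \<iota> ` S \<union> (if x0 \<in> S then - K else {})"
    proof (intro set_eqI iffI)
      fix p assume p: "p \<in> \<kappa> -` S \<inter> space borel"
      show "p \<in> \<iota> ` S \<union> (if x0 \<in> S then - K else {})"
      proof (cases "p \<in> K")
        case True
        then obtain x where "p = \<iota> x" "x \<in> space X" by (auto simp: K_def)
        then show ?thesis using p \<kappa>\<iota> by auto
      qed (use p in \<open>simp add: \<kappa>_def\<close>)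
    next
      fix p assume p: "p \<in> \<iota> ` S \<union> (if x0 \<in> S then - K else {})"
      show "p \<in> \<kappa> -` S \<inter> space borel"
      proof (cases "p \<in> \<iota> ` S")
        case True
        then show ?thesis using \<kappa>\<iota> sets.sets_into_space[OF S] by auto
      qed (use p in \<open>simp add: \<kappa>_def split: if_splits\<close>)
    qed
    moreover have "- K \<in> sets borel" by (simp add: borel_comp)
    ultimately show "\<kappa> -` S \<inter> space borel \<in> sets borel" using \<iota>(3) S by simp
  qed
  define B where "B = {z \<in> space (borel \<Otimes>\<^sub>M borel). fst z \<in> K \<and> snd z \<in> K \<and> (\<kappa> (fst z), \<kappa> (snd z)) \<in> G}"
  note [measurable] = GX
  have Bm: "B \<in> sets (borel \<Otimes>\<^sub>M borel)" unfolding B_def by measurable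
  have B: "B = {(\<iota> x, \<iota> y) |x y. (x, y) \<in> G}"
  proof (intro set_eqI iffI)
    fix z assume z: "z \<in> B"
    then obtain x y where "x \<in> space X" "y \<in> space X" "z = (\<iota> x, \<iota> y)"
      unfolding B_def K_def by (cases z) auto
    then show "z \<in> {(\<iota> x, \<iota> y) |x y. (x, y) \<in> G}" using z \<kappa>\<iota> by (auto simp: B_def)
  next
    fix z assume "z \<in> {(\<iota> x, \<iota> y) |x y. (x, y) \<in> G}"
    then show "z \<in> B" using Gsub \<kappa>\<iota> by (auto simp: B_def K_def space_pair_measure)
  qed
  have symB: "sym B" using symG unfolding B sym_def by blast
  have fin: "finite {y. (p, y) \<in> B}" for p
  proof (cases "p \<in> K")
    case True
    then obtain x where x: "p = \<iota> x" "x \<in> space X" by (auto simp: K_def)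
    have "{y. (p, y) \<in> B} \<subseteq> \<iota> ` (G `` {x})"
    proof
      fix q assume "q \<in> {y. (p, y) \<in> B}"
      then obtain x' y where "p = \<iota> x'" "q = \<iota> y" "(x', y) \<in> G" unfolding B by blast
      then show "q \<in> \<iota> ` (G `` {x})" using x Gsub \<iota>(2) by (auto dest: inj_onD)
    qed
    then show ?thesis using lf x(2) unfolding locally_finite_graph_def by (blast intro: finite_subset)
  next
    case False
    then have "{y. (p, y) \<in> B} = {}" unfolding B_def by auto
    then show ?thesis by simp
  qed
  obtain D g g' where Dgg: "(\<forall>k :: nat. D k \<in> sets borel \<and> g k \<in> borel_measurable borel \<and>
            g' k \<in> borel_measurable borel \<and> (\<forall>x\<in>D k. g' k (g k x) = x)) \<and>
           B = (\<Union>k. {(x, g k x) |x. x \<in> D k})"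
    using sym_finite_sections_injections[OF Bm symB fin] by (elim exE)
  have D: "D k \<in> sets borel" and g[measurable]: "g k \<in> borel_measurable borel"
    and g'[measurable]: "g' k \<in> borel_measurable borel" and g'g: "\<forall>x\<in>D k. g' k (g k x) = x" for k
    using Dgg by simp_all
  have BD: "B = (\<Union>k. {(x, g k x) |x. x \<in> D k})" using Dgg by simp
  have DK: "x \<in> K" "g k x \<in> K" if "x \<in> D k" for k x
  proof -
    have "(x, g k x) \<in> B" unfolding BD using that by blast
    then show "x \<in> K" "g k x \<in> K" by (auto simp: B_def)
  qed
  have "D k \<subseteq> K" for k using DK by blast
  from borel_maps_continuous[of K D g, OF \<open>K \<in> sets borel\<close> D g this]
  obtain c where cc: "c \<in> borel_measurable borel \<and> (\<forall>x. slice 0 (c x) = x) \<and> closed (c ` K) \<and>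
           (\<forall>k. openin (top_of_set (c ` K)) (c ` D k) \<and>
                continuous_on (c ` D k) (\<lambda>p. c (g k (slice 0 p))))"
    by (elim exE)
  have [measurable]: "c \<in> borel_measurable borel" and c0: "slice 0 (c x) = x" for x using cc by simp_all
  have c_borel: "c ` S \<in> sets borel" if [measurable]: "S \<in> sets borel" for S
  proof -
    have "c ` S = {p \<in> space borel. slice 0 p \<in> S \<and> (\<forall>i. c (slice 0 p) i = p i)}"
    proof (intro set_eqI iffI)
      fix p assume "p \<in> {p \<in> space borel. slice 0 p \<in> S \<and> (\<forall>i. c (slice 0 p) i = p i)}"
      then have "slice 0 p \<in> S" "c (slice 0 p) = p" by (auto simp: fun_eq_iff)
      then show "p \<in> c ` S" by (metis imageI)
    qed (auto simp: c0)
    also have "\<dots> \<in> sets borel" by measurable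
    finally show ?thesis .
  qed
  define j where "j = c \<circ> \<iota>"
  have jX: "j ` space X = c ` K" by (simp add: j_def K_def image_comp)
  let ?H = "{(j x, j y) |x y. (x, y) \<in> G}"
  have Hc: "?H = {(c a, c b) |a b. (a, b) \<in> B}" unfolding B j_def by auto
  have gg: "generated_graph (c ` K) (\<lambda>k. c ` D k) (\<lambda>k p. c (g k (slice 0 p))) (\<lambda>k p. c (g' k (slice 0 p))) ?H"
  proof
    show "closed (c ` K)" using cc by simp
    show "openin (top_of_set (c ` K)) (c ` D k)" for k using cc by simp
    show "continuous_on (c ` D k) (\<lambda>p. c (g k (slice 0 p)))" for k using cc by simp
    show "c (g k (slice 0 a)) \<in> c ` K" if "a \<in> c ` D k" for a k using that DK by (auto simp: c0)
    show "(\<lambda>p. c (g k (slice 0 p))) \<in> borel_measurable borel" for k by measurable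
    show "(\<lambda>p. c (g' k (slice 0 p))) \<in> borel_measurable borel" for k by measurable
    show "c (g' k (slice 0 (c (g k (slice 0 a))))) = a" if "a \<in> c ` D k" for a k
      using that g'g by (auto simp: c0)
    show "?H = (\<Union>k. {(a, c (g k (slice 0 a))) |a. a \<in> c ` D k})"
      unfolding Hc
    proof (intro set_eqI iffI)
      fix z assume "z \<in> {(c a, c b) |a b. (a, b) \<in> B}"
      then obtain a b where z: "z = (c a, c b)" "(a, b) \<in> B" by blast
      then obtain k where "a \<in> D k" "b = g k a" using BD by auto
      then have "z = (c a, c (g k (slice 0 (c a))))" "c a \<in> c ` D k" by (simp_all add: c0 z)
      then show "z \<in> (\<Union>k. {(a, c (g k (slice 0 a))) |a. a \<in> c ` D k})" by blast
    next
      fix z assume "z \<in> (\<Union>k. {(a, c (g k (slice 0 a))) |a. a \<in> c ` D k})"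
      then obtain k a where a: "a \<in> D k" "z = (c a, c (g k a))" by (auto simp: c0)
      then have "(a, g k a) \<in> B" using BD by blast
      then show "z \<in> {(c a, c b) |a b. (a, b) \<in> B}" using a by blast
    qed
    show "sym ?H" using symG unfolding sym_def by blast
  qed
  have jm: "j \<in> borel_measurable X" unfolding j_def comp_def using \<iota>(1) by measurable
  have ji: "inj_on j (space X)"
  proof (rule inj_onI)
    fix x y assume xy: "x \<in> space X" "y \<in> space X" "j x = j y"
    have "slice 0 (j x) = \<iota> x" for x by (simp add: j_def c0)
    from this[of x] this[of y] have "\<iota> x = \<iota> y" using xy(3) by simp
    then show "x = y" using inj_onD[OF \<iota>(2)] xy(1,2) by blast
  qed
  have jS: "\<forall>S\<in>sets X. j ` S \<in> sets borel"
  proof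
    fix S assume "S \<in> sets X"
    then have "c ` (\<iota> ` S) \<in> sets borel" using \<iota>(3) by (intro c_borel) blast
    then show "j ` S \<in> sets borel" by (simp add: j_def image_comp)
  qed
  show ?thesis by (intro exI conjI, rule gg) (rule jm ji jX jS refl)+
qed

context generated_graph
begin

lemma borel_F: "F \<in> sets borel"
  using closed_F by simp

lemma borel_D: "D k \<in> sets borel"
proof -
  obtain U where "open U" "D k = F \<inter> U" using open_D[of k] by (auto simp: openin_open)
  then show ?thesis using borel_F by simp
qed

text \<open>A neighbour of \<open>a\<close> is of the form \<open>g k a\<close>, so a quantifier over neighbours is a countable one.\<close>
lemma borel_pow_preimage:
  assumes "A \<in> sets borel"
  shows "{a. \<exists>b\<in>A. (a, b) \<in> H ^^ n} \<in> sets borel"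
proof (induction n)
  case 0
  then show ?case using assms by simp
next
  case (Suc n)
  define S where "S = {a. \<exists>b\<in>A. (a, b) \<in> H ^^ n}"
  note [measurable] = Suc[folded S_def] borel_D measurable_g
  have "{a. \<exists>b\<in>A. (a, b) \<in> H ^^ Suc n} = (\<Union>k. {a \<in> space borel. a \<in> D k \<and> g k a \<in> S})"
  proof (intro set_eqI iffI)
    fix a assume "a \<in> {a. \<exists>b\<in>A. (a, b) \<in> H ^^ Suc n}"
    then obtain b a' where "b \<in> A" "(a, a') \<in> H" "(a', b) \<in> H ^^ n" by (auto elim!: relpow_Suc_E2 simp del: relpow.simps)
    moreover from this obtain k where "a \<in> D k" "a' = g k a" using H_eq by auto
    ultimately show "a \<in> (\<Union>k. {a \<in> space borel. a \<in> D k \<and> g k a \<in> S})" by (auto simp: S_def)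
  next
    fix a assume "a \<in> (\<Union>k. {a \<in> space borel. a \<in> D k \<and> g k a \<in> S})"
    then obtain k b where "a \<in> D k" "b \<in> A" "(g k a, b) \<in> H ^^ n" by (auto simp: S_def)
    moreover from this have "(a, g k a) \<in> H" using H_eq by auto
    ultimately have "(a, b) \<in> H ^^ Suc n" by (intro relpow_Suc_I2)
    then show "a \<in> {a. \<exists>b\<in>A. (a, b) \<in> H ^^ Suc n}" using \<open>b \<in> A\<close> by blast
  qed
  also have "\<dots> \<in> sets borel" by measurable
  finally show ?case .
qed

end

section \<open>Discrete orbits and smoothness\<close>

lemma continuous_on_prefix:
  fixes f :: "(nat \<Rightarrow> nat) \<Rightarrow> nat \<Rightarrow> nat"
  assumes "continuous_on S f" "b \<in> S"
  shows "\<exists>m. \<forall>a\<in>S. (\<forall>i<m. a i = b i) \<longrightarrow> (\<forall>i<n. f a i = f b i)"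
proof -
  have "\<exists>U. open U \<and> U \<inter> S = f -` {c. \<forall>i<n. c i = f b i} \<inter> S"
    using assms(1)[unfolded continuous_on_open_invariant] open_cylinder[of n "f b"] by (elim allE impE)
  then obtain U where U: "open U" "U \<inter> S = f -` {c. \<forall>i<n. c i = f b i} \<inter> S" by (elim exE conjE)
  then have "b \<in> U" using assms(2) by auto
  then obtain m where "\<forall>a. (\<forall>i<m. a i = b i) \<longrightarrow> a \<in> U" using open_imp_cylinder[OF U(1)] by blast
  then show ?thesis using U(2) by blast
qed

text \<open>Base 3 leaves room between the contribution of one digit and the sum of all later ones.\<close>
lemma ternary_series_inj:
  fixes z w :: "nat \<Rightarrow> bool"
  assumes eq: "(\<Sum>n. if z n then (1 / 3) ^ n else 0 :: real) = (\<Sum>n. if w n then (1 / 3) ^ n else 0)"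
  shows "z = w"
proof -
  have summ: "summable (\<lambda>n. if z n then (1 / 3) ^ n else 0 :: real)" for z :: "nat \<Rightarrow> bool"
    by (rule summable_comparison_test'[OF summable_geometric[of "1 / 3 :: real"], of 0]) auto
  have False if ne: "z n" "\<not> w n" "\<And>i. i < n \<Longrightarrow> z i = w i"
    and eq: "(\<Sum>n. if z n then (1 / 3) ^ n else 0 :: real) = (\<Sum>n. if w n then (1 / 3) ^ n else 0)"
    for z w :: "nat \<Rightarrow> bool" and n
  proof -
    let ?f = "\<lambda>(z :: nat \<Rightarrow> bool) n. if z n then (1 / 3) ^ n else 0 :: real"
    have split: "suminf (?f z) = (\<Sum>i. ?f z (i + Suc n)) + (\<Sum>i<Suc n. ?f z i)" for z
      by (rule suminf_split_initial_segment[OF summ])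
    have "(\<Sum>i. ?f w (i + Suc n)) \<le> (\<Sum>i. (1 / 3) ^ (i + Suc n))"
    proof (rule suminf_le)
      show "summable (\<lambda>i. ?f w (i + Suc n))" using summable_iff_shift[of "?f w" "Suc n"] summ by blast
      show "summable (\<lambda>i. (1 / 3 :: real) ^ (i + Suc n))" 
        using summable_iff_shift[of "\<lambda>i. (1 / 3 :: real) ^ i" "Suc n"] summable_geometric by fastforce
    qed auto
    also have "\<dots> = (\<Sum>i. (1 / 3) ^ Suc n * (1 / 3) ^ i)" by (simp add: power_add mult_ac)
    also have "\<dots> = (1 / 3) ^ Suc n * (\<Sum>i. (1 / 3) ^ i)" by (rule suminf_mult) (simp add: summable_geometric)
    also have "\<dots> = (1 / 3) ^ Suc n * (1 / (1 - 1 / 3 :: real))"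
      by (subst suminf_geometric) auto
    also have "\<dots> < (1 / 3) ^ n" by simp
    finally have tail: "(\<Sum>i. ?f w (i + Suc n)) < (1 / 3) ^ n" .
    have "0 \<le> (\<Sum>i. ?f z (i + Suc n))"
      by (rule suminf_nonneg) (use summable_iff_shift[of "?f z" "Suc n"] summ in auto)
    moreover have "(\<Sum>i<n. ?f z i) = (\<Sum>i<n. ?f w i)" using ne(3) by (intro sum.cong) auto
    then have "(\<Sum>i<Suc n. ?f z i) = (\<Sum>i<Suc n. ?f w i) + (1 / 3) ^ n" using ne(1,2) by simp
    ultimately have "suminf (?f w) < suminf (?f z)" unfolding split using tail by linarith
    then show False using eq by simp
  qed
  note * = this
  show ?thesis
  proof (rule ccontr)
    assume "z \<noteq> w"
    then have ex: "\<exists>n. z n \<noteq> w n" by auto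
    define n where "n = (LEAST n. z n \<noteq> w n)"
    have "z n \<noteq> w n" using LeastI_ex[OF ex] by (simp add: n_def)
    moreover have "z i = w i" if "i < n" for i using not_less_Least[of i "\<lambda>n. z n \<noteq> w n"] that by (simp add: n_def)
    ultimately show False using *[of z n w] *[of w n z] eq by metis
  qed
qed

context generated_graph
begin

definition cyl :: "(nat \<Rightarrow> nat) \<Rightarrow> nat \<Rightarrow> (nat \<Rightarrow> nat) set" where
  "cyl p l = {a \<in> F. \<forall>i<l. a i = p i}"

lemma cyl_mono: "l \<le> m \<Longrightarrow> cyl p m \<subseteq> cyl p l"
  by (auto simp: cyl_def)

lemma borel_cyl: "cyl p l \<in> sets borel"
proof -
  have "cyl p l = F \<inter> {a. \<forall>i<l. a i = p i}" by (auto simp: cyl_def)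
  then show ?thesis using closed_F closed_cylinder by (simp add: closed_Int)
qed

lemma openin_cyl: "openin (top_of_set F) (cyl p l)"
proof -
  have "cyl p l = F \<inter> {a. \<forall>i<l. a i = p i}" by (auto simp: cyl_def)
  then show ?thesis by (simp add: openin_open_Int open_cylinder)
qed

lemma openin_contains_cyl:
  assumes "openin (top_of_set F) V" "p \<in> V"
  shows "\<exists>m. cyl p m \<subseteq> V"
proof -
  obtain U where U: "open U" "V = F \<inter> U" using assms(1) by (auto simp: openin_open)
  then obtain m where "\<forall>a. (\<forall>i<m. a i = p i) \<longrightarrow> a \<in> U" using open_imp_cylinder[OF U(1)] assms(2) by blast
  then show ?thesis using U(2) by (auto simp: cyl_def)
qed

text \<open>The set of basic neighbourhoods that the orbit of \<open>a\<close> meets is a complete invariant.  Indeed let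
  \<open>a\<close> and \<open>b\<close> have the same invariant, and let \<open>cyl a l\<close> isolate \<open>a\<close> in its orbit.  The orbit of
  \<open>b\<close> has a point \<open>b'\<close> in \<open>cyl a l\<close>, and every neighbourhood of \<open>b'\<close> contains a point of the orbit of \<open>a\<close>,
  which can only be \<open>a\<close>; so \<open>b' = a\<close>.\<close>
theorem smooth_if_orbits_discrete:
  assumes iso: "\<And>a. a \<in> F \<Longrightarrow> \<exists>l. \<forall>b\<in>cyl a l. (a, b) \<in> H\<^sup>* \<longrightarrow> b = a"
  shows "\<exists>\<psi> :: (nat \<Rightarrow> nat) \<Rightarrow> real. \<psi> \<in> borel_measurable borel \<and>
           (\<forall>a\<in>F. \<forall>b\<in>F. (a, b) \<in> H\<^sup>* \<longleftrightarrow> \<psi> a = \<psi> b)"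
proof -
  define A where "A n = {b \<in> F. \<forall>i<length (from_nat n :: nat list). b i = (from_nat n :: nat list) ! i}" for n
  define hit where "hit a n \<longleftrightarrow> (\<exists>b\<in>A n. (a, b) \<in> H\<^sup>*)" for a n
  define \<psi> where "\<psi> a = (\<Sum>n. if hit a n then (1 / 3) ^ n else 0 :: real)" for a
  have A: "A (to_nat (map c [0..<l])) = cyl c l" for c l by (auto simp: A_def cyl_def)
  have bA: "A n \<in> sets borel" for n
    using borel_cyl[of "\<lambda>i. (from_nat n :: nat list) ! i" "length (from_nat n :: nat list)"]
    unfolding A_def cyl_def .
  have "{a. hit a n} \<in> sets borel" for n
  proof -
    have "{a. hit a n} = (\<Union>k. {a. \<exists>b\<in>A n. (a, b) \<in> H ^^ k})"
      by (auto simp: hit_def rtrancl_power)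
    then show ?thesis using borel_pow_preimage[OF bA] by auto
  qed
  then have [measurable]: "Measurable.pred borel (\<lambda>a. hit a n)" for n by (simp add: pred_def)
  have "\<psi> \<in> borel_measurable borel" unfolding \<psi>_def by measurable
  moreover have "(a, b) \<in> H\<^sup>* \<longleftrightarrow> \<psi> a = \<psi> b" if ab: "a \<in> F" "b \<in> F" for a b
  proof
    assume "(a, b) \<in> H\<^sup>*"
    moreover from this have "(b, a) \<in> H\<^sup>*" using sym_rtrancl[OF sym_H] by (auto dest: symD)
    ultimately have "hit a = hit b" unfolding hit_def by (intro ext) (blast intro: rtrancl_trans)
    then show "\<psi> a = \<psi> b" by (simp add: \<psi>_def)
  next
    assume "\<psi> a = \<psi> b"
    then have "hit a = hit b" unfolding \<psi>_def by (rule ternary_series_inj)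
    then have eq: "(\<exists>c'\<in>cyl c l. (a, c') \<in> H\<^sup>*) \<longleftrightarrow> (\<exists>c'\<in>cyl c l. (b, c') \<in> H\<^sup>*)" for c l
      unfolding A[symmetric] hit_def by (rule fun_cong)
    obtain l where l: "\<forall>c\<in>cyl a l. (a, c) \<in> H\<^sup>* \<longrightarrow> c = a" using iso ab by blast
    have "a \<in> cyl a l" using ab by (simp add: cyl_def)
    then obtain b' where b': "b' \<in> cyl a l" "(b, b') \<in> H\<^sup>*" using eq by blast
    have "a i = b' i" for i
    proof -
      have "b' \<in> cyl b' (Suc (i + l))" using b'(1) by (simp add: cyl_def)
      then obtain c where c: "c \<in> cyl b' (Suc (i + l))" "(a, c) \<in> H\<^sup>*" using eq b'(2) by blast
      then have "c \<in> cyl a l" using b'(1) by (auto simp: cyl_def)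
      then have "c = a" using l c(2) by blast
      then show ?thesis using c(1) by (auto simp: cyl_def)
    qed
    then have "b' = a" by auto
    then show "(a, b) \<in> H\<^sup>*" using b'(2) sym_rtrancl[OF sym_H] by (auto dest: symD)
  qed
  ultimately show ?thesis by blast
qed

end

section \<open>Binary sequences in an accumulating orbit\<close>

context generated_graph
begin

text \<open>The composition of the maps along a path from \<open>p\<close> to \<open>q\<close>.\<close>
lemma path_map:
  assumes "(p, q) \<in> H ^^ n" "p \<in> F"
  shows "\<exists>w w' V. w \<in> borel_measurable borel \<and> w' \<in> borel_measurable borel \<and>
           openin (top_of_set F) V \<and> p \<in> V \<and> continuous_on V w \<and> w p = q \<and>
           (\<forall>a\<in>V. w a \<in> F \<and> w' (w a) = a \<and> (a, w a) \<in> H ^^ n)"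
  using assms
proof (induction n arbitrary: q)
  case 0
  then show ?case
    by (intro exI[of _ "\<lambda>a. a"] exI[of _ F]) (auto intro: continuous_on_id)
next
  case (Suc n)
  then obtain r where r: "(p, r) \<in> H ^^ n" "(r, q) \<in> H" by auto
  obtain w w' V where w: "w \<in> borel_measurable borel" "w' \<in> borel_measurable borel"
    "openin (top_of_set F) V" "p \<in> V" "continuous_on V w" "w p = r"
    "\<And>a. a \<in> V \<Longrightarrow> w a \<in> F \<and> w' (w a) = a \<and> (a, w a) \<in> H ^^ n"
    using Suc.IH[OF r(1) Suc.prems(2)] by blast
  obtain k where k: "r \<in> D k" "q = g k r" using r(2) H_eq by auto
  define V' where "V' = V \<inter> w -` D k"
  have "openin (top_of_set V) V'"
    unfolding V'_def by (rule continuous_openin_preimage[OF w(5) _ open_D]) (use w(7) in auto)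
  then have V': "openin (top_of_set F) V'" using w(3) by (rule openin_trans)
  have "continuous_on V' (\<lambda>a. g k (w a))"
    by (rule continuous_on_compose2[OF continuous_g[of k]])
      (auto simp: V'_def intro: continuous_on_subset[OF w(5)])
  moreover have "g k (w a) \<in> F \<and> w' (g' k (g k (w a))) = a \<and> (a, g k (w a)) \<in> H ^^ Suc n"
    if "a \<in> V'" for a
  proof -
    have a: "a \<in> V" "w a \<in> D k" using that by (auto simp: V'_def)
    then have "(w a, g k (w a)) \<in> H" using H_eq by auto
    then show ?thesis using a w(7)[OF a(1)] g_in_F g'_g by auto
  qed
  moreover have "(\<lambda>a. g k (w a)) \<in> borel_measurable borel" "(\<lambda>a. w' (g' k a)) \<in> borel_measurable borel"
    using w(1,2) measurable_g measurable_g' by (auto intro: measurable_compose)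
  ultimately show ?case
    using V' w(4,6) k by (intro exI[of _ "\<lambda>a. g k (w a)"] exI[of _ "\<lambda>a. w' (g' k a)"] exI[of _ V']) (auto simp: V'_def)
qed

lemma common_prefix:
  fixes \<A> :: "((nat \<Rightarrow> nat) \<Rightarrow> nat \<Rightarrow> nat) set"
  assumes "finite \<A>" "\<And>\<alpha>. \<alpha> \<in> \<A> \<Longrightarrow> continuous_on V \<alpha>" "openin (top_of_set F) V" "p \<in> V"
  shows "\<exists>m. cyl p m \<subseteq> V \<and> (\<forall>\<alpha>\<in>\<A>. \<forall>a\<in>cyl p m. \<forall>i<n. \<alpha> a i = \<alpha> p i)"
proof -
  obtain m0 where m0: "cyl p m0 \<subseteq> V" using openin_contains_cyl assms by blast
  have "\<forall>\<alpha>\<in>\<A>. \<exists>m. \<forall>a\<in>V. (\<forall>i<m. a i = p i) \<longrightarrow> (\<forall>i<n. \<alpha> a i = \<alpha> p i)"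
    by (intro ballI continuous_on_prefix assms(2,4))
  from bchoice[OF this] obtain m
    where m: "\<forall>\<alpha>\<in>\<A>. \<forall>a\<in>V. (\<forall>i<m \<alpha>. a i = p i) \<longrightarrow> (\<forall>i<n. \<alpha> a i = \<alpha> p i)" ..
  define M where "M = m0 + (\<Sum>\<alpha>\<in>\<A>. m \<alpha>)"
  have "m \<alpha> \<le> M" if "\<alpha> \<in> \<A>" for \<alpha>
    using member_le_sum[of \<alpha> \<A> m] that assms(1) by (simp add: M_def trans_le_add2)
  note mM = this
  have V: "cyl p M \<subseteq> V" using m0 cyl_mono[of m0 M p] by (auto simp: M_def)
  have "\<alpha> a i = \<alpha> p i" if "\<alpha> \<in> \<A>" "a \<in> cyl p M" "i < n" for \<alpha> a i
  proof -
    have "\<forall>i<m \<alpha>. a i = p i" using that(2) mM[OF that(1)] by (auto simp: cyl_def)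
    then show ?thesis using m that V by blast
  qed
  then show ?thesis using V by blast
qed

text \<open>As \<open>p\<close> is an accumulation point of its orbit, a path leads from \<open>p\<close> to another point of
  \<open>cyl p l\<close>.  The map \<open>w\<close> along it moves a small neighbourhood of \<open>p\<close> to a disjoint one inside \<open>cyl p l\<close>.
  The neighbourhood can be taken so small that the finitely many maps already constructed, and their
  compositions with \<open>w\<close>, have images of small diameter.\<close>
lemma splitting_step:
  fixes \<A> :: "((nat \<Rightarrow> nat) \<Rightarrow> nat \<Rightarrow> nat) set"
  assumes acc: "\<And>l. \<exists>q\<in>cyl p l. (p, q) \<in> H\<^sup>* \<and> q \<noteq> p" and p: "p \<in> F"
    and \<A>: "finite \<A>" "\<And>\<alpha>. \<alpha> \<in> \<A> \<Longrightarrow> continuous_on (cyl p l) \<alpha>"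
  shows "\<exists>m w w' e. l \<le> m \<and> w \<in> borel_measurable borel \<and> w' \<in> borel_measurable borel \<and>
           continuous_on (cyl p m) w \<and>
           (\<forall>a\<in>cyl p m. w a \<in> cyl p l - cyl p m \<and> w' (w a) = a \<and> (a, w a) \<in> H ^^ e) \<and>
           (\<forall>\<alpha>\<in>\<A> \<union> (\<lambda>\<alpha>. \<alpha> \<circ> w) ` \<A>. \<forall>a\<in>cyl p m. \<forall>i<n. \<alpha> a i = \<alpha> p i)"
proof -
  obtain q where q: "q \<in> cyl p l" "(p, q) \<in> H\<^sup>*" "q \<noteq> p" using acc by blast
  obtain e where e: "(p, q) \<in> H ^^ e" using q(2) by (auto simp: rtrancl_power)
  obtain i0 where i0: "q i0 \<noteq> p i0" using q(3) by auto
  obtain w w' V where w: "w \<in> borel_measurable borel" "w' \<in> borel_measurable borel"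
    "openin (top_of_set F) V" "p \<in> V" "continuous_on V w" "w p = q"
    "\<And>a. a \<in> V \<Longrightarrow> w a \<in> F \<and> w' (w a) = a \<and> (a, w a) \<in> H ^^ e"
    using path_map[OF e p] by blast
  obtain m1 where m1: "cyl p m1 \<subseteq> V" "\<And>a i. a \<in> cyl p m1 \<Longrightarrow> i < Suc (l + i0) \<Longrightarrow> w a i = q i"
    using common_prefix[of "{w}" V p "Suc (l + i0)"] w by auto
  define V1 where "V1 = cyl p (m1 + l)"
  have V1: "V1 \<subseteq> V" "V1 \<subseteq> cyl p l" "V1 \<subseteq> cyl p m1" "p \<in> V1" "openin (top_of_set F) V1"
    using m1(1) cyl_mono[of m1 "m1 + l" p] cyl_mono[of l "m1 + l" p] p openin_cyl
    by (auto simp: V1_def) (simp add: cyl_def)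
  have wl: "w a \<in> cyl p l" if "a \<in> V1" for a
  proof -
    have a: "a \<in> cyl p m1" "a \<in> V" using that V1 by blast+
    have "w a i = p i" if "i < l" for i
      using m1(2)[OF a(1), of i] that q(1) by (simp add: cyl_def)
    then show ?thesis using w(7)[OF a(2)] by (simp add: cyl_def)
  qed
  have cw: "continuous_on V1 w" using w(5) V1(1) by (rule continuous_on_subset)
  have c\<A>: "continuous_on V1 \<alpha>" if "\<alpha> \<in> \<A> \<union> (\<lambda>\<alpha>. \<alpha> \<circ> w) ` \<A>" for \<alpha>
    using that
  proof
    assume "\<alpha> \<in> \<A>"
    then show ?thesis using \<A>(2) V1(2) by (blast intro: continuous_on_subset)
  next
    assume "\<alpha> \<in> (\<lambda>\<alpha>. \<alpha> \<circ> w) ` \<A>"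
    then obtain \<beta> where \<beta>: "\<beta> \<in> \<A>" "\<alpha> = \<beta> \<circ> w" by blast
    have "w ` V1 \<subseteq> cyl p l" using wl by blast
    then show ?thesis unfolding \<beta>(2)
      by (intro continuous_on_compose[OF cw] continuous_on_subset[OF \<A>(2)[OF \<beta>(1)]])
  qed
  have "finite (\<A> \<union> (\<lambda>\<alpha>. \<alpha> \<circ> w) ` \<A>)" using \<A>(1) by simp
  then have "\<exists>m. cyl p m \<subseteq> V1 \<and>
      (\<forall>\<alpha>\<in>\<A> \<union> (\<lambda>\<alpha>. \<alpha> \<circ> w) ` \<A>. \<forall>a\<in>cyl p m. \<forall>i<n. \<alpha> a i = \<alpha> p i)"
    by (rule common_prefix[OF _ c\<A> V1(5,4)])
  then obtain m2 where m2: "cyl p m2 \<subseteq> V1"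
    "\<forall>\<alpha>\<in>\<A> \<union> (\<lambda>\<alpha>. \<alpha> \<circ> w) ` \<A>. \<forall>a\<in>cyl p m2. \<forall>i<n. \<alpha> a i = \<alpha> p i"
    by (elim exE conjE)
  define m where "m = m2 + l + Suc i0"
  have m: "cyl p m \<subseteq> cyl p m2" "l \<le> m" "i0 < m" using cyl_mono[of m2 m p] by (simp_all add: m_def)
  have "w a \<in> cyl p l - cyl p m \<and> w' (w a) = a \<and> (a, w a) \<in> H ^^ e" if a: "a \<in> cyl p m" for a
  proof -
    have aV: "a \<in> V1" using a m(1) m2(1) by blast
    have "w a i0 = q i0" using m1(2)[of a i0] aV V1(3) by auto
    then have "w a \<notin> cyl p m" using i0 m(3) by (auto simp: cyl_def)
    then show ?thesis using wl[OF aV] w(7)[of a] aV V1(1) by blast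
  qed
  moreover have "continuous_on (cyl p m) w"
    using cw by (rule continuous_on_subset) (use m(1) m2(1) in blast)
  moreover have "\<forall>\<alpha>\<in>\<A> \<union> (\<lambda>\<alpha>. \<alpha> \<circ> w) ` \<A>. \<forall>a\<in>cyl p m. \<forall>i<n. \<alpha> a i = \<alpha> p i"
    using m2(2) m(1) by blast
  ultimately show ?thesis using w(1,2) m(2)
    by (intro exI[of _ m] exI[of _ w] exI[of _ w'] exI[of _ e]) blast
qed

end

text \<open>The composition of those \<open>W i\<close> with \<open>i < n\<close> and \<open>z i\<close>, with \<open>W 0\<close> applied last.\<close>
primrec act :: "(nat \<Rightarrow> (nat \<Rightarrow> nat) \<Rightarrow> nat \<Rightarrow> nat) \<Rightarrow> nat \<Rightarrow> (nat \<Rightarrow> bool) \<Rightarrow> (nat \<Rightarrow> nat) \<Rightarrow> nat \<Rightarrow> nat" where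
  "act W 0 z a = a"
| "act W (Suc n) z a = act W n z (if z n then W n a else a)"

text \<open>Shrinking neighbourhoods \<open>cyl p (L n)\<close> of \<open>p\<close> and maps \<open>W n\<close> that move the next neighbourhood off
  itself but not out of the present one, along paths of length \<open>E n\<close>.  The last condition bounds the
  diameter of the images, so that the maps \<open>act W n z\<close> converge on \<open>p\<close>.\<close>
locale splitting_scheme = generated_graph +
  fixes p :: "nat \<Rightarrow> nat" and L :: "nat \<Rightarrow> nat"
    and W W' :: "nat \<Rightarrow> (nat \<Rightarrow> nat) \<Rightarrow> nat \<Rightarrow> nat" and E :: "nat \<Rightarrow> nat"
  assumes p_in_F: "p \<in> F"
    and L_Suc: "L n \<le> L (Suc n)"
    and measurable_W: "W n \<in> borel_measurable borel"
    and measurable_W': "W' n \<in> borel_measurable borel"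
    and W_in: "a \<in> cyl p (L (Suc n)) \<Longrightarrow> W n a \<in> cyl p (L n)"
    and W_notin: "a \<in> cyl p (L (Suc n)) \<Longrightarrow> W n a \<notin> cyl p (L (Suc n))"
    and W'_W: "a \<in> cyl p (L (Suc n)) \<Longrightarrow> W' n (W n a) = a"
    and W_path: "a \<in> cyl p (L (Suc n)) \<Longrightarrow> (a, W n a) \<in> H ^^ E n"
    and continuous_act: "continuous_on (cyl p (L n)) (act W n z)"
    and act_prefix: "a \<in> cyl p (L n) \<Longrightarrow> i < n \<Longrightarrow> act W n z a i = act W n z p i"

text \<open>The state of the recursive construction: the current neighbourhood, all maps \<open>act W n z\<close> so far,
  and the map chosen last with its left inverse and the length of its paths.\<close>
datatype stage = Stage (level: nat) (maps: "((nat \<Rightarrow> nat) \<Rightarrow> nat \<Rightarrow> nat) set")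
  (fwd: "(nat \<Rightarrow> nat) \<Rightarrow> nat \<Rightarrow> nat") (bwd: "(nat \<Rightarrow> nat) \<Rightarrow> nat \<Rightarrow> nat") (steps: nat)

context generated_graph
begin

text \<open>Iterate \<open>splitting_step\<close>.  For fixed \<open>n\<close> there are only finitely many maps \<open>act W n z\<close>, as these
  depend on the first \<open>n\<close> values of \<open>z\<close>, so each stage has to control only finitely many maps.\<close>
theorem splitting_scheme_exists:
  assumes acc: "\<And>l. \<exists>q\<in>cyl p l. (p, q) \<in> H\<^sup>* \<and> q \<noteq> p" and p: "p \<in> F"
  shows "\<exists>L W W' E. splitting_scheme F D g g' H p L W W' E"
proof -
  define good where "good n s \<longleftrightarrow> finite (maps s) \<and>
      (\<forall>\<alpha>\<in>maps s. continuous_on (cyl p (level s)) \<alpha>) \<and> (n = 0 \<longrightarrow> maps s = {\<lambda>a. a})" for n :: nat and s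
  define refines where "refines n s t \<longleftrightarrow>
       maps t = maps s \<union> (\<lambda>\<alpha>. \<alpha> \<circ> fwd t) ` maps s \<and> level s \<le> level t \<and>
       fwd t \<in> borel_measurable borel \<and> bwd t \<in> borel_measurable borel \<and>
       (\<forall>a\<in>cyl p (level t). fwd t a \<in> cyl p (level s) - cyl p (level t) \<and>
          bwd t (fwd t a) = a \<and> (a, fwd t a) \<in> H ^^ steps t) \<and>
       (\<forall>\<alpha>\<in>maps t. \<forall>a\<in>cyl p (level t). \<forall>i<Suc n. \<alpha> a i = \<alpha> p i)" for n s t
  have "\<exists>S. \<forall>n. good n (S n) \<and> refines n (S n) (S (Suc n))"
  proof (rule dependent_nat_choice)
    show "\<exists>s. good 0 s"
      by (intro exI[of _ "Stage 0 {\<lambda>a. a} (\<lambda>a. a) (\<lambda>a. a) 0"]) (simp add: good_def continuous_on_id)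
  next
    fix s and n :: nat
    assume "good n s"
    then have s: "finite (maps s)" "\<And>\<alpha>. \<alpha> \<in> maps s \<Longrightarrow> continuous_on (cyl p (level s)) \<alpha>"
      by (simp_all add: good_def)
    have "\<exists>m w w' e. level s \<le> m \<and> w \<in> borel_measurable borel \<and> w' \<in> borel_measurable borel \<and>
           continuous_on (cyl p m) w \<and>
           (\<forall>a\<in>cyl p m. w a \<in> cyl p (level s) - cyl p m \<and> w' (w a) = a \<and> (a, w a) \<in> H ^^ e) \<and>
           (\<forall>\<alpha>\<in>maps s \<union> (\<lambda>\<alpha>. \<alpha> \<circ> w) ` maps s. \<forall>a\<in>cyl p m. \<forall>i<Suc n. \<alpha> a i = \<alpha> p i)"
      by (rule splitting_step[OF acc p s(1)]) (rule s(2))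
    then obtain m w w' e where m: "level s \<le> m" and w: "w \<in> borel_measurable borel"
      "w' \<in> borel_measurable borel" and cw: "continuous_on (cyl p m) w"
      and wa: "\<forall>a\<in>cyl p m. w a \<in> cyl p (level s) - cyl p m \<and> w' (w a) = a \<and> (a, w a) \<in> H ^^ e"
      and pre: "\<forall>\<alpha>\<in>maps s \<union> (\<lambda>\<alpha>. \<alpha> \<circ> w) ` maps s. \<forall>a\<in>cyl p m. \<forall>i<Suc n. \<alpha> a i = \<alpha> p i"
      by (elim exE conjE)
    define t where "t = Stage m (maps s \<union> (\<lambda>\<alpha>. \<alpha> \<circ> w) ` maps s) w w' e"
    have t: "level t = m" "maps t = maps s \<union> (\<lambda>\<alpha>. \<alpha> \<circ> w) ` maps s" "fwd t = w" "bwd t = w'" "steps t = e"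
      by (simp_all add: t_def)
    have "continuous_on (cyl p m) \<alpha>" if "\<alpha> \<in> maps s \<union> (\<lambda>\<alpha>. \<alpha> \<circ> w) ` maps s" for \<alpha>
      using that
    proof
      assume "\<alpha> \<in> maps s"
      then show ?thesis using s(2) cyl_mono[OF m] by (blast intro: continuous_on_subset)
    next
      assume "\<alpha> \<in> (\<lambda>\<alpha>. \<alpha> \<circ> w) ` maps s"
      then obtain \<beta> where \<beta>: "\<beta> \<in> maps s" "\<alpha> = \<beta> \<circ> w" by blast
      have "w ` cyl p m \<subseteq> cyl p (level s)" using wa by blast
      then show ?thesis unfolding \<beta>(2)
        by (intro continuous_on_compose[OF cw] continuous_on_subset[OF s(2)[OF \<beta>(1)]])
    qed
    then have "good (Suc n) t" unfolding good_def t using s(1) by simp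
    moreover have "refines n s t"
      unfolding refines_def t by (intro conjI refl m w wa pre)
    ultimately show "\<exists>t. good (Suc n) t \<and> refines n s t" by blast
  qed
  then obtain S where "\<forall>n. good n (S n) \<and> refines n (S n) (S (Suc n))" ..
  then have good: "good n (S n)" and ref: "refines n (S n) (S (Suc n))" for n by simp_all
  define W where "W n = fwd (S (Suc n))" for n
  have maps_0: "maps (S 0) = {\<lambda>a. a}" using good[of 0] by (simp add: good_def)
  have maps_Suc: "maps (S (Suc n)) = maps (S n) \<union> (\<lambda>\<alpha>. \<alpha> \<circ> W n) ` maps (S n)" for n
    using ref[of n] by (simp add: refines_def W_def)
  have act: "act W n z \<in> maps (S n)" for n z
  proof (induction n)
    case 0
    then show ?case by (simp add: maps_0 fun_eq_iff)
  next
    case (Suc n)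
    have "act W (Suc n) z = (if z n then act W n z \<circ> W n else act W n z)" by (simp add: fun_eq_iff)
    then show ?case using Suc by (simp add: maps_Suc)
  qed
  have "splitting_scheme F D g g' H p (\<lambda>n. level (S n)) W (\<lambda>n. bwd (S (Suc n))) (\<lambda>n. steps (S (Suc n)))"
  proof
    show "p \<in> F" by (rule p)
    show "continuous_on (cyl p (level (S n))) (act W n z)" for n z
      using good[of n] act[of n z] by (simp add: good_def)
    show "act W n z a i = act W n z p i" if ai: "a \<in> cyl p (level (S n))" "i < n" for a n i z
    proof -
      obtain m where n: "n = Suc m" using ai(2) by (cases n) auto
      have "\<forall>\<alpha>\<in>maps (S n). \<forall>a\<in>cyl p (level (S n)). \<forall>i<n. \<alpha> a i = \<alpha> p i"
        using ref[of m] unfolding n refines_def by (elim conjE)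
      then show ?thesis using act[of n z] ai by blast
    qed
  qed (use ref in \<open>simp_all add: refines_def W_def\<close>)
  then show ?thesis by blast
qed

end

context splitting_scheme
begin

lemma p_in_cyl: "p \<in> cyl p l"
  using p_in_F by (simp add: cyl_def)

text \<open>Clearing the first \<open>n\<close> bits.  Sequences that agree from \<open>n\<close> on have the same masked sequence, which is
  how finite differences are compared below.\<close>
definition mask :: "nat \<Rightarrow> (nat \<Rightarrow> bool) \<Rightarrow> nat \<Rightarrow> bool" where
  "mask n z = (\<lambda>i. n \<le> i \<and> z i)"

lemma mask_0 [simp]: "mask 0 z = z"
  by (simp add: mask_def)

lemma act_mask [simp]: "act W n (mask n z) a = a"
proof -
  have "act W k (mask n z) a = a" if "k \<le> n" for k
    using that by (induction k) (auto simp: mask_def)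
  then show ?thesis by simp
qed

lemma act_split: "n \<le> m \<Longrightarrow> act W m z a = act W n z (act W m (mask n z) a)"
proof (induction m arbitrary: a rule: dec_induct)
  case (step m)
  then have "mask n z m = z m" by (simp add: mask_def)
  then show ?case using step.IH by simp
qed simp

lemma step_in: "a \<in> cyl p (L (Suc m)) \<Longrightarrow> (if b then W m a else a) \<in> cyl p (L m)"
  using W_in[of a m] cyl_mono[OF L_Suc[of m], of p] by auto

lemma act_in: "n \<le> m \<Longrightarrow> a \<in> cyl p (L m) \<Longrightarrow> act W m (mask n z) a \<in> cyl p (L n)"
proof (induction m arbitrary: a rule: dec_induct)
  case (step m)
  show ?case using step.IH[OF step_in[OF step.prems]] by simp
qed simp

text \<open>The limit of \<open>act W m z p\<close>, whose \<open>i\<close>-th value no longer changes once \<open>m > i\<close>.\<close>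
definition lim_act :: "(nat \<Rightarrow> bool) \<Rightarrow> nat \<Rightarrow> nat" where
  "lim_act z i = act W (Suc i) z p i"

lemma act_eq_lim: "i < m \<Longrightarrow> act W m z p i = lim_act z i"
proof (induction m)
  case (Suc m)
  show ?case
  proof (cases "i = m")
    case False
    then have im: "i < m" using Suc.prems by simp
    have "act W (Suc m) z p i = act W m z p i"
      using act_prefix[OF step_in[OF p_in_cyl] im] by simp
    then show ?thesis using Suc.IH[OF im] by simp
  qed (simp add: lim_act_def)
qed simp

lemma lim_act_in: "lim_act (mask n z) \<in> cyl p (L n)"
proof -
  have *: "act W m (mask n z) p \<in> cyl p (L n)" if "n \<le> m" for m
    by (rule act_in[OF that p_in_cyl])
  have "lim_act (mask n z) \<in> F"
  proof (rule ccontr)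
    assume "lim_act (mask n z) \<notin> F"
    then obtain m where m: "\<forall>a. (\<forall>i<m. a i = lim_act (mask n z) i) \<longrightarrow> a \<in> - F"
      using open_imp_cylinder[of "- F" "lim_act (mask n z)"] closed_F by auto
    have "act W (m + n) (mask n z) p \<in> - F" using m act_eq_lim[of _ "m + n"] by simp
    then show False using *[of "m + n"] by (simp add: cyl_def)
  qed
  moreover have "lim_act (mask n z) i = p i" if "i < L n" for i
    using *[of "n + Suc i"] that act_eq_lim[of i "n + Suc i" "mask n z"] by (simp add: cyl_def del: act.simps)
  ultimately show ?thesis by (simp add: cyl_def)
qed

lemma lim_act_in_F: "lim_act z \<in> F"
  using lim_act_in[of 0 z] by (simp add: cyl_def)

text \<open>The map \<open>act W n z\<close> is continuous on \<open>cyl p (L n)\<close>, so it commutes with the limit.\<close>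
lemma lim_act_split: "lim_act z = act W n z (lim_act (mask n z))"
proof
  fix i
  obtain m where m: "\<forall>a\<in>cyl p (L n). (\<forall>j<m. a j = lim_act (mask n z) j) \<longrightarrow>
      (\<forall>j<Suc i. act W n z a j = act W n z (lim_act (mask n z)) j)"
    using continuous_on_prefix[OF continuous_act lim_act_in, of n z "Suc i"] by blast
  define k where "k = n + m + Suc i"
  have "act W k (mask n z) p \<in> cyl p (L n)" by (rule act_in[OF _ p_in_cyl]) (simp add: k_def)
  moreover have "act W k (mask n z) p j = lim_act (mask n z) j" if "j < m" for j
    using that by (intro act_eq_lim) (simp add: k_def)
  ultimately have "act W n z (act W k (mask n z) p) i = act W n z (lim_act (mask n z)) i"
    using m by blast
  moreover have "act W k z p = act W n z (act W k (mask n z) p)" by (rule act_split) (simp add: k_def)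
  moreover have "act W k z p i = lim_act z i" by (rule act_eq_lim) (simp add: k_def)
  ultimately show "lim_act z i = act W n z (lim_act (mask n z)) i" by metis
qed

lemma lim_act_step:
  "lim_act (mask n z) = (if z n then W n (lim_act (mask (Suc n) z)) else lim_act (mask (Suc n) z))"
proof -
  have "mask (Suc n) (mask n z) = mask (Suc n) z" "mask n z n = z n" by (auto simp: mask_def fun_eq_iff)
  then show ?thesis using lim_act_split[of "mask n z" "Suc n"] by simp
qed

text \<open>The bits of \<open>z\<close> are recovered from \<open>lim_act z\<close> one at a time: the bit is set if and only if the
  point lies outside the next neighbourhood, and in that case \<open>W n\<close> is undone.\<close>
primrec unwind :: "nat \<Rightarrow> (nat \<Rightarrow> nat) \<Rightarrow> nat \<Rightarrow> nat" where
  "unwind 0 a = a"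
| "unwind (Suc n) a = (if unwind n a \<in> cyl p (L (Suc n)) then unwind n a else W' n (unwind n a))"

lemma unwind_lim: "unwind n (lim_act z) = lim_act (mask n z)"
proof (induction n)
  case (Suc n)
  then show ?case
    using lim_act_step[of n z] lim_act_in[of "Suc n" z] W_notin[of _ n] W'_W[of _ n] by (cases "z n") auto
qed simp

definition bit :: "nat \<Rightarrow> (nat \<Rightarrow> nat) \<Rightarrow> bool" where
  "bit n a \<longleftrightarrow> unwind n a \<notin> cyl p (L (Suc n))"

lemma bit_lim: "bit n (lim_act z) \<longleftrightarrow> z n"
  unfolding bit_def unwind_lim
  using lim_act_step[of n z] lim_act_in[of "Suc n" z] W_notin[of _ n] by auto

lemma measurable_unwind: "unwind n \<in> borel_measurable borel"
proof (induction n)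
  case 0
  have "unwind 0 = (\<lambda>a. a)" by (simp add: fun_eq_iff)
  then show ?case by simp
next
  case (Suc n)
  note [measurable] = Suc measurable_W'[of n] borel_cyl[of p "L (Suc n)"]
  have "unwind (Suc n) = (\<lambda>a. if unwind n a \<in> cyl p (L (Suc n)) then unwind n a else W' n (unwind n a))"
    by (simp add: fun_eq_iff)
  then show ?case by (simp only:) measurable
qed

lemma measurable_bit: "Measurable.pred borel (bit n)"
proof -
  note [measurable] = measurable_unwind[of n] borel_cyl[of p "L (Suc n)"]
  show ?thesis unfolding bit_def by measurable
qed

lemma measurable_act:
  assumes "\<And>n. Measurable.pred M (\<lambda>x. z x n)" "a \<in> borel_measurable M"
  shows "(\<lambda>x. act W n (z x) (a x)) \<in> borel_measurable M"
  using assms(2)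
proof (induction n arbitrary: a)
  case (Suc n)
  note [measurable] = assms(1)[of n] Suc.prems measurable_W[of n]
  have "(\<lambda>x. if z x n then W n (a x) else a x) \<in> borel_measurable M" by measurable
  from Suc.IH[OF this] show ?case by simp
qed simp

lemma measurable_lim_act:
  assumes "\<And>n. Measurable.pred M (\<lambda>x. z x n)"
  shows "(\<lambda>x. lim_act (z x)) \<in> borel_measurable M"
proof (rule measurable_coordinatewise_then_product)
  fix i
  have "(\<lambda>x. act W (Suc i) (z x) p) \<in> borel_measurable M"
    by (rule measurable_act[OF assms]) simp
  from measurable_coord[OF this, of i] show "(\<lambda>x. lim_act (z x) i) \<in> borel_measurable M"
    unfolding lim_act_def .
qed

lemma act_path:
  "a \<in> cyl p (L n) \<Longrightarrow> \<exists>r\<le>(\<Sum>i<n. E i). (a, act W n z a) \<in> H ^^ r"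
proof (induction n arbitrary: a)
  case 0
  then show ?case by (intro exI[of _ 0]) simp
next
  case (Suc n)
  define b where "b = (if z n then W n a else a)"
  obtain r where r: "r \<le> (\<Sum>i<n. E i)" "(b, act W n z b) \<in> H ^^ r"
    using Suc.IH[OF step_in[OF Suc.prems]] unfolding b_def by blast
  have "\<exists>e\<le>E n. (a, b) \<in> H ^^ e"
    using W_path[OF Suc.prems] by (cases "z n") (auto simp: b_def intro: exI[of _ 0])
  then obtain e where e: "e \<le> E n" "(a, b) \<in> H ^^ e" by blast
  have "(a, act W n z b) \<in> H ^^ (e + r)" using r(2) e(2) by (auto simp: relpow_add)
  then show ?case using r(1) e(1) by (intro exI[of _ "e + r"]) (simp add: b_def)
qed

lemma sym_H_pow: "(a, b) \<in> H ^^ n \<Longrightarrow> (b, a) \<in> H ^^ n"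
proof (induction n arbitrary: b)
  case (Suc n)
  then obtain c where "(a, c) \<in> H ^^ n" "(c, b) \<in> H" by auto
  then show ?case using Suc.IH sym_H by (meson relpow_Suc_I2 symD)
qed simp

text \<open>Both limits are reached from the limit of the common masked sequence by paths of length at most
  the sum of the \<open>E i\<close> with \<open>i < n\<close>.\<close>
lemma lim_act_dist:
  assumes "\<And>i. n \<le> i \<Longrightarrow> z i = z' i"
  shows "\<exists>r\<le>2 * (\<Sum>i<n. E i). (lim_act z, lim_act z') \<in> H ^^ r"
proof -
  have eq: "mask n z = mask n z'" using assms by (auto simp: mask_def)
  define b where "b = lim_act (mask n z)"
  have "b \<in> cyl p (L n)" unfolding b_def by (rule lim_act_in)
  then obtain r r' where r: "r \<le> (\<Sum>i<n. E i)" "(b, act W n z b) \<in> H ^^ r"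
    "r' \<le> (\<Sum>i<n. E i)" "(b, act W n z' b) \<in> H ^^ r'" using act_path by meson
  have "(act W n z b, act W n z' b) \<in> H ^^ (r + r')"
    using sym_H_pow[OF r(2)] r(4) by (auto simp: relpow_add)
  moreover have "act W n z b = lim_act z" "act W n z' b = lim_act z'"
    unfolding b_def using lim_act_split[of z n] lim_act_split[of z' n] eq by simp_all
  ultimately show ?thesis using r(1,3) by (intro exI[of _ "r + r'"]) simp
qed

end

section \<open>Domination of marker distances\<close>

context splitting_scheme
begin

text \<open>The characteristic function of the graph of \<open>x\<close>.  In contrast to the values themselves, changing
  one value of \<open>x\<close> changes only two bits.\<close>
definition graph_bits :: "(nat \<Rightarrow> nat) \<Rightarrow> nat \<Rightarrow> bool" where
  "graph_bits x c \<longleftrightarrow> x (fst (prod_decode c)) = snd (prod_decode c)"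

definition decode :: "(nat \<Rightarrow> nat) \<Rightarrow> nat \<Rightarrow> nat" where
  "decode a i = (LEAST k. bit (prod_encode (i, k)) a)"

lemma decode_lim: "decode (lim_act (graph_bits x)) = x"
  by (rule ext) (auto simp: decode_def bit_lim graph_bits_def intro: Least_equality)

lemma measurable_decode: "decode \<in> borel_measurable borel"
proof -
  note [measurable] = measurable_bit
  have "(\<lambda>a. LEAST k. bit (prod_encode (i, k)) a) \<in> borel_measurable borel" for i
    by (rule borel_measurable_into_nat) measurable
  then show ?thesis
    by (intro measurable_coordinatewise_then_product) (simp add: decode_def)
qed

text \<open>An index beyond all codes \<open>(i, k)\<close> with \<open>i \<le> x n\<close> and \<open>k\<close> at most \<open>x n\<close> or equal to \<open>x i\<close>; the sum bounds
  all these \<open>x i\<close>.  Only these bits change when a prefix of length at most \<open>x n\<close> is replaced by values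
  of at most \<open>x n\<close>.\<close>
definition reach :: "(nat \<Rightarrow> nat) \<Rightarrow> nat \<Rightarrow> nat" where
  "reach x n = Suc (prod_encode (x n, x n + (\<Sum>i\<le>x n. x i)))"

lemma prod_encode_mono: "i \<le> i' \<Longrightarrow> k \<le> k' \<Longrightarrow> prod_encode (i, k) \<le> prod_encode (i', k')"
proof -
  assume a: "i \<le> i'" "k \<le> k'"
  have "triangle m \<le> triangle m'" if "m \<le> m'" for m m'
    using that by (rule lift_Suc_mono_le[of triangle, rotated]) simp
  then show ?thesis using a by (simp add: prod_encode_def add_mono)
qed

lemma graph_bits_graft:
  assumes "m \<le> x n" "\<And>i. i < m \<Longrightarrow> u i \<le> x n" "reach x n \<le> c"
  shows "graph_bits x c = graph_bits (graft m u x) c"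
proof (rule ccontr)
  obtain i k where c: "c = prod_encode (i, k)" by (metis prod_decode_inverse surj_pair)
  assume "\<not> ?thesis"
  then have im: "i < m" and k: "k = x i \<or> k = u i"
    by (auto simp: graph_bits_def c graft_def split: if_splits)
  have "i \<le> x n" using im assms(1) by simp
  then have "x i \<le> (\<Sum>i\<le>x n. x i)" by (intro member_le_sum) auto
  then have "k \<le> x n + (\<Sum>i\<le>x n. x i)" using k assms(2)[OF im] by auto
  then have "c < reach x n"
    unfolding c reach_def using prod_encode_mono[OF \<open>i \<le> x n\<close>] by (simp add: less_Suc_eq_le)
  then show False using assms(3) by simp
qed

text \<open>Let \<open>P n r\<close> be the set of sequences from whose points a walk of length \<open>r\<close> leads into
  \<open>A n\<close>.  The sequence \<open>x\<close> from \<open>hechler_domination\<close> differs on a prefix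
  from an element of \<open>P n r\<close>, where \<open>r\<close>, the length and the values of the prefix are at most \<open>x n\<close>.  The two
  points are then at distance at most \<open>2 * (\<Sum>i<reach x n. E i)\<close>.  All these bounds can be computed from \<open>x\<close>,
  and \<open>x\<close> from its point, so \<open>f\<close> is Borel.\<close>
theorem marker_domination:
  "\<exists>f :: (nat \<Rightarrow> nat) \<Rightarrow> nat \<Rightarrow> nat. f \<in> borel_measurable borel \<and>
     (\<forall>A. (\<forall>n. A n \<in> sets borel \<and> (\<forall>a\<in>F. \<exists>b\<in>A n. (a, b) \<in> H\<^sup>*)) \<longrightarrow>
       (\<exists>a\<in>F. \<forall>n. \<exists>b\<in>A n. \<exists>r<f a n. (a, b) \<in> H ^^ r))"
proof -
  define f where "f a n = Suc (decode a n + 2 * (\<Sum>i<reach (decode a) n. E i))" for a n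
  have "f \<in> borel_measurable borel"
  proof (rule measurable_coordinatewise_then_product)
    fix n
    note [measurable] = measurable_decode
    have 1: "(\<lambda>a. \<Sum>i\<le>m. decode a i) \<in> measurable borel (count_space UNIV)" for m
      by (induction m) (simp_all, measurable)
    have 2: "(\<lambda>a. \<Sum>i\<le>decode a n. decode a i) \<in> measurable borel (count_space UNIV)"
      by (rule measurable_compose_countable[OF 1]) measurable
    have 3: "(\<lambda>a. Suc (k + 2 * (\<Sum>i<Suc (prod_encode (k, k + (\<Sum>i\<le>decode a n. decode a i))). E i)))
        \<in> measurable borel (count_space UNIV)" for k
      by (rule measurable_compose[OF 2, of "\<lambda>s. Suc (k + 2 * (\<Sum>i<Suc (prod_encode (k, k + s)). E i))"]) simp
    have "(\<lambda>a. f a n) \<in> measurable borel (count_space UNIV)"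
      unfolding f_def reach_def
      by (rule measurable_compose_countable[OF 3 measurable_coord_count[OF measurable_decode]])
    then show "(\<lambda>a. f a n) \<in> borel_measurable borel" by (rule borel_measurable_into_nat)
  qed
  moreover have "\<exists>a\<in>F. \<forall>n. \<exists>b\<in>A n. \<exists>r<f a n. (a, b) \<in> H ^^ r"
    if A: "\<forall>n. A n \<in> sets borel \<and> (\<forall>a\<in>F. \<exists>b\<in>A n. (a, b) \<in> H\<^sup>*)" for A
  proof -
    define P where "P n r = {x. \<exists>b\<in>A n. (lim_act (graph_bits x), b) \<in> H ^^ r}" for n r
    have "Measurable.pred borel (\<lambda>x. graph_bits x c)" for c
      unfolding graph_bits_def by measurable
    then have m[measurable]: "(\<lambda>x. lim_act (graph_bits x)) \<in> borel_measurable borel"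
      by (rule measurable_lim_act)
    have Pm: "P n r \<in> sets borel" for n r
    proof -
      have [measurable]: "{a. \<exists>b\<in>A n. (a, b) \<in> H ^^ r} \<in> sets borel" by (rule borel_pow_preimage) (use A in simp)
      have "P n r = {x \<in> space borel. lim_act (graph_bits x) \<in> {a. \<exists>b\<in>A n. (a, b) \<in> H ^^ r}}"
        by (simp add: P_def)
      also have "\<dots> \<in> sets borel" by measurable
      finally show ?thesis .
    qed
    have Pc: "(\<Union>r. P n r) = UNIV" for n
    proof -
      have "x \<in> (\<Union>r. P n r)" for x
        using A lim_act_in_F[of "graph_bits x"] by (fastforce simp: P_def rtrancl_power)
      then show ?thesis by blast
    qed
    from hechler_domination[of P, OF Pm Pc]
    obtain x where x: "\<forall>n. \<exists>r m u. graft m u x \<in> P n r \<and> r \<le> x n \<and> m \<le> x n \<and> (\<forall>i<m. u i \<le> x n)" ..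
    show ?thesis
    proof (rule bexI[of _ "lim_act (graph_bits x)"], rule allI)
      fix n
      obtain r m u where u: "graft m u x \<in> P n r" "r \<le> x n" "m \<le> x n" "\<forall>i<m. u i \<le> x n" using x by blast
      then obtain b where b: "b \<in> A n" "(lim_act (graph_bits (graft m u x)), b) \<in> H ^^ r" by (auto simp: P_def)
      obtain r' where r': "r' \<le> 2 * (\<Sum>i<reach x n. E i)"
        "(lim_act (graph_bits x), lim_act (graph_bits (graft m u x))) \<in> H ^^ r'"
        using lim_act_dist[of "reach x n" "graph_bits x" "graph_bits (graft m u x)"]
          graph_bits_graft[of m x n u] u(3,4) by blast
      have "(lim_act (graph_bits x), b) \<in> H ^^ (r' + r)" using r'(2) b(2) by (auto simp: relpow_add)
      moreover have "r' + r < f (lim_act (graph_bits x)) n" using r'(1) u(2) by (simp add: f_def decode_lim)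
      ultimately show "\<exists>b\<in>A n. \<exists>r<f (lim_act (graph_bits x)) n. (lim_act (graph_bits x), b) \<in> H ^^ r"
        using b(1) by blast
    qed (rule lim_act_in_F)
  qed
  ultimately show ?thesis by blast
qed

end

section \<open>Nonsmooth locally finite graphs\<close>

lemma standard_borel_space_real: "standard_borel_space (borel :: real measure)"
  unfolding standard_borel_space_def
proof (intro exI conjI)
  show "completely_metrizable_space (euclidean :: real topology)"
    by (rule completely_metrizable_space_euclidean)
  show "separable_space (euclidean :: real topology)"
  proof (rule second_countable_imp_separable_space)
    obtain B :: "real set set" where B: "countable B" "topological_basis B"
      using ex_countable_basis by blast
    have "\<exists>V\<in>B. x \<in> V \<and> V \<subseteq> U" if "open U" "x \<in> U" for U x
      using topological_basisE[OF B(2) that] by metis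
    then show "second_countable (euclidean :: real topology)"
      unfolding second_countable_def using B(1) topological_basis_open[OF B(2)]
      by (intro exI[of _ B]) simp
  qed
  show "sets borel = sigma_sets (topspace (euclidean :: real topology)) {U. openin euclidean U}"
    by (simp add: sets_borel)
qed simp

lemma smooth_graphI_real:
  assumes "\<psi> \<in> borel_measurable X"
    and "\<And>x y. x \<in> space X \<Longrightarrow> y \<in> space X \<Longrightarrow> (x, y) \<in> G\<^sup>* \<longleftrightarrow> \<psi> x = (\<psi> y :: real)"
  shows "smooth_graph X G"
  unfolding smooth_graph_def
  by (intro exI[of _ borel] exI[of _ \<psi>] conjI standard_borel_space_real assms(1) ballI)
    (simp add: connectedness_rel_def assms(2))

lemma relpow_image_iff:
  assumes j: "inj_on j S" and G: "G \<subseteq> S \<times> S" and xy: "x \<in> S" "y \<in> S"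
  shows "(j x, j y) \<in> {(j x, j y) |x y. (x, y) \<in> G} ^^ n \<longleftrightarrow> (x, y) \<in> G ^^ n"
  using xy(2)
proof (induction n arbitrary: y)
  case 0
  then show ?case using j xy(1) by (auto dest: inj_onD)
next
  case (Suc n)
  let ?H = "{(j x, j y) |x y. (x, y) \<in> G}"
  show ?case
  proof
    assume "(j x, j y) \<in> ?H ^^ Suc n"
    then obtain b where b: "(j x, b) \<in> ?H ^^ n" "(b, j y) \<in> ?H" by auto
    then obtain z y' where z: "b = j z" "j y = j y'" "(z, y') \<in> G" by auto
    then have "z \<in> S" "y' = y" using G j Suc.prems by (auto dest: inj_onD)
    then show "(x, y) \<in> G ^^ Suc n" using Suc.IH b(1) z by auto
  next
    assume "(x, y) \<in> G ^^ Suc n"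
    then obtain z where z: "(x, z) \<in> G ^^ n" "(z, y) \<in> G" by auto
    then have "z \<in> S" using G by blast
    then show "(j x, j y) \<in> ?H ^^ Suc n" using Suc.IH z by auto
  qed
qed

theorem theorem1p2:
  fixes X :: "'a measure" and G :: "('a \<times> 'a) set"
  assumes "standard_borel_space X"
    and "borel_graph X G"
    and "locally_finite_graph X G"
    and "\<not> smooth_graph X G"
  shows "\<exists>f :: 'a \<Rightarrow> nat \<Rightarrow> nat. f \<in> borel_measurable X \<and>
           (\<forall>A. borel_marker_sequence X G A \<longrightarrow>
              (\<exists>x\<in>space X. \<forall>n. graph_set_dist X G x (A n) < enat (f x n)))"
proof -
  have ne: "space X \<noteq> {}"
    using smooth_graphI_real[of "\<lambda>_. 0" X G] assms(4) by auto
  obtain j F D g g' H where gen: "generated_graph F D g g' H" and j: "j \<in> borel_measurable X"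
      "inj_on j (space X)" "j ` space X = F" "\<forall>S\<in>sets X. j ` S \<in> sets borel"
    and H: "H = {(j x, j y) |x y. (x, y) \<in> G}"
    using graph_realization[OF assms(1) ne assms(2,3)] by (elim exE conjE)
  interpret generated_graph F D g g' H by (rule gen)
  have "G \<in> sets (X \<Otimes>\<^sub>M X)" using assms(2) by (simp add: borel_graph_def)
  then have GX: "G \<subseteq> space X \<times> space X"
    using sets.sets_into_space[of G "X \<Otimes>\<^sub>M X"] by (simp add: space_pair_measure)
  have pow: "(j x, j y) \<in> H ^^ n \<longleftrightarrow> (x, y) \<in> G ^^ n" if "x \<in> space X" "y \<in> space X" for x y n
    unfolding H by (rule relpow_image_iff[OF j(2) GX that])
  have conn: "(j x, j y) \<in> H\<^sup>* \<longleftrightarrow> (x, y) \<in> G\<^sup>*" if "x \<in> space X" "y \<in> space X" for x y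
    unfolding rtrancl_power using pow[OF that] by simp
  obtain p where p: "p \<in> F" "\<And>l. \<exists>q\<in>cyl p l. (p, q) \<in> H\<^sup>* \<and> q \<noteq> p"
  proof -
    have "\<exists>p\<in>F. \<forall>l. \<exists>q\<in>cyl p l. (p, q) \<in> H\<^sup>* \<and> q \<noteq> p"
    proof (rule ccontr)
      assume "\<not> ?thesis"
      then have "\<exists>l. \<forall>b\<in>cyl a l. (a, b) \<in> H\<^sup>* \<longrightarrow> b = a" if "a \<in> F" for a using that by blast
      then have "\<exists>\<psi> :: (nat \<Rightarrow> nat) \<Rightarrow> real. \<psi> \<in> borel_measurable borel \<and>
          (\<forall>a\<in>F. \<forall>b\<in>F. (a, b) \<in> H\<^sup>* \<longleftrightarrow> \<psi> a = \<psi> b)"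
        by (rule smooth_if_orbits_discrete)
      then obtain \<psi> :: "(nat \<Rightarrow> nat) \<Rightarrow> real"
        where \<psi>: "\<psi> \<in> borel_measurable borel" "\<forall>a\<in>F. \<forall>b\<in>F. (a, b) \<in> H\<^sup>* \<longleftrightarrow> \<psi> a = \<psi> b"
        by (elim exE conjE)
      have "smooth_graph X G"
      proof (rule smooth_graphI_real)
        show "(\<lambda>x. \<psi> (j x)) \<in> borel_measurable X" by (rule measurable_compose[OF j(1) \<psi>(1)])
        fix x y assume xy: "x \<in> space X" "y \<in> space X"
        then have "j x \<in> F" "j y \<in> F" using j(3) by blast+
        then show "(x, y) \<in> G\<^sup>* \<longleftrightarrow> \<psi> (j x) = \<psi> (j y)" using \<psi>(2) conn[OF xy] by blast
      qed
      then show False using assms(4) by simp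
    qed
    then show ?thesis using that by blast
  qed
  obtain L W W' E where "splitting_scheme F D g g' H p L W W' E"
    using splitting_scheme_exists[OF p(2,1)] by (elim exE)
  then interpret splitting_scheme F D g g' H p L W W' E .
  obtain f :: "(nat \<Rightarrow> nat) \<Rightarrow> nat \<Rightarrow> nat" where f: "f \<in> borel_measurable borel"
    "\<forall>A. (\<forall>n. A n \<in> sets borel \<and> (\<forall>a\<in>F. \<exists>b\<in>A n. (a, b) \<in> H\<^sup>*)) \<longrightarrow>
       (\<exists>a\<in>F. \<forall>n. \<exists>b\<in>A n. \<exists>r<f a n. (a, b) \<in> H ^^ r)"
    using marker_domination by (elim exE conjE)
  show ?thesis
  proof (intro exI conjI allI impI)
    show "(\<lambda>x. f (j x)) \<in> borel_measurable X" by (rule measurable_compose[OF j(1) f(1)])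
    fix A assume A: "borel_marker_sequence X G A"
    have AX: "A n \<subseteq> space X" "A n \<in> sets X" for n
      using A by (simp_all add: borel_marker_sequence_def marker_set_def)
    have "\<exists>b\<in>j ` A n. (a, b) \<in> H\<^sup>*" if aF: "a \<in> F" for a n
    proof -
      obtain x where x: "a = j x" "x \<in> space X" using aF j(3) by blast
      have "connectedness_rel X G `` {x} \<in> space X // connectedness_rel X G"
        using x(2) by (rule quotientI)
      then have "A n \<inter> connectedness_rel X G `` {x} \<noteq> {}"
        using A unfolding borel_marker_sequence_def marker_set_def by blast
      then obtain y where y: "y \<in> A n" "(x, y) \<in> G\<^sup>*" by (auto simp: connectedness_rel_def)
      then have "(j x, j y) \<in> H\<^sup>*" using conn[OF x(2)] AX(1) by blast
      then show ?thesis using x(1) y(1) by blast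
    qed
    then have "\<forall>n. j ` A n \<in> sets borel \<and> (\<forall>a\<in>F. \<exists>b\<in>j ` A n. (a, b) \<in> H\<^sup>*)"
      using j(4) AX(2) by simp
    with f(2)[THEN spec, of "\<lambda>n. j ` A n"]
    obtain a where a: "a \<in> F" "\<forall>n. \<exists>b\<in>j ` A n. \<exists>r<f a n. (a, b) \<in> H ^^ r" by (elim impE bexE)
    then obtain x where x: "a = j x" "x \<in> space X" using j(3) by blast
    have "graph_set_dist X G x (A n) < enat (f (j x) n)" for n
    proof -
      obtain y r where y: "y \<in> A n" "r < f (j x) n" "(j x, j y) \<in> H ^^ r" using a(2) x(1) by blast
      have yX: "y \<in> space X" using AX(1) y(1) by blast
      have r: "(x, y) \<in> G ^^ r" using y(3) pow[OF x(2) yX] by simp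
      then have "(x, y) \<in> connectedness_rel X G"
        using x(2) yX by (auto simp: connectedness_rel_def intro: relpow_imp_rtrancl)
      then have "graph_set_dist X G x (A n) \<le> graph_dist G x y"
        unfolding graph_set_dist_def using y(1) by (intro INF_lower) simp
      also have "\<dots> \<le> enat r" unfolding graph_dist_def using r by (intro INF_lower) simp
      also have "\<dots> < enat (f (j x) n)" using y(2) by simp
      finally show ?thesis .
    qed
    then show "\<exists>x\<in>space X. \<forall>n. graph_set_dist X G x (A n) < enat (f (j x) n)" using x(2) by blast
  qed
qed

end
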